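(* Consider a piecewise-deterministic Markov process on $E$ satisfying the assumptions listed in the context, let $A\in\mathcal{C}_2$, let $\{B_1,\dots,B_p\}$ be an admissible family and let $1\le k\le p$. Let $0<t<t^\star(A)$. For any $x\in E$, when $n$ goes to infinity, $$\sup_{0\le s\le t}\left|\widehat p_n(A,B_k,s)-\widetilde H(A,B_k,s)\right|\to0\quad\mathbf{P}_x\text{-a.s.}$$
   Context: **Process.** $E$ is a nonempty open subset of a separable metric space $(\mathcal{E},d)$; all functions and kernels are Borel measurable. $\Phi:E\times\mathbf{R}_+\to\overline{E}$ is a flow: $\Phi(\xi,t+s)=\Phi(\Phi(\xi,t),s)$ (whenever the right side is defined), and $t^\star(\xi)=\inf\{t>0:\Phi(\xi,t)\in\partial E\}$. The jump rate $\lambda:\overline{E}\to\mathbf{R}_+$ satisfies: for all $\xi\in E$ there is $\varepsilon>0$ with $\int_0^\varepsilon\lambda(\Phi(\xi,s))\,ds<\infty$. $Q$ is a Markov kernel on $\overline{E}$ with $Q(\xi,\overline{E}\setminus\{\xi\})=1$ and $Q(\xi,E)=1$ for all $\xi\in\overline E$. Put $\overline\lambda(\xi,t)=\lambda(\Phi(\xi,t))$, $\overline Q(\xi,t,B)=Q(\Phi(\xi,t),B)$, $G(\xi,t)=\exp(-\int_0^t\overline\lambda(\xi,s)\,ds)$, $f(\xi,t)=\overline\lambda(\xi,t)G(\xi,t)$. The embedded chain $(Z_n,S_n)_{n\ge0}$ ($Z_n$ post-jump locations, $S_n$ interarrival times, $S_0=0$) satisfies: for every $n\ge 0$, conditionally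 on the past up to index $n$ with $Z_n=x$, $\mathbf{P}(S_{n+1}>t)=G(x,t)\mathbf{1}_{\{0\le t<t^\star(x)\}}$, and, given moreover $S_{n+1}=s$, $Z_{n+1}$ has law $\overline Q(x,s,\cdot)$. $\mathbf{P}_x$ is the probability when $Z_0=x$. **Assumptions.** Let $\mathcal{C}_1$ be the set of Borel subsets of $E$ with non-empty interior, and $\mathcal{C}_2$ the set of relatively compact $A\in\mathcal{C}_1$ with $\overline{A}\cap\partial E=\emptyset$. For $A\in\mathcal{C}_2$, $t^\star(A)=\inf_{\xi\in A}t^\star(\xi)$. Let $d_2((x,y),(u,v))=d(x,u)+d(y,v)$. (1a) $\overline Q(\xi,s,B)=\int_B\widetilde Q(\xi,s,y)\,\mu(dy)$, where $\mu$ is a measure on $E$ with $\mu(B)>0$ for every measurable $B$ with non-empty interior. (1b) $\widetilde Q(x,\cdot,y)$ is continuous for all $x,y\in E$. (1c) There is $m>0$ with $\widetilde Q(x,s,y)\ge m$ for all $x,y\in E,s\ge0$. (1d) For any $e>0$ there exist $p\ge2$ and pairwise non-overlapping (disjoint) sets $B_1,\dots,B_p\in\mathcal{C}_1$ with $\max_k\operatorname{diam}B_k<e$ and $\sum_{k=1}^p\overline Q(x,t,B_k)=1$ for all $x\in E,t\ge0$; $B_1$ is taken to have the largest diameter. A family as in (1d), for some $e>0$, is called admissible. (2a) $f(\xi,\cdot)$ is strictly positive and continuous for every $\xi\in E$. (2b) There is a locally integrable $M:\mathbf{R}_+\to\mathbf{R}_+$ with $\overline\lambda(\xi,t)\le M(t)$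 for all $\xi\in E$, $t\geq 0$. (2c) $t^\star:E\to\mathbf{R}_+$ is bounded. (2d) There is a constant $[f\widetilde Q]_{Lip}$ with $|f(x,t)\widetilde Q(x,t,y)-f(u,t)\widetilde Q(u,t,v)|\le[f\widetilde Q]_{Lip}\,d_2((x,y),(u,v))$ for all $x,y,u,v\in E$, $0\le t<t^\star(x)\wedge t^\star(u)$. (2e) There is a constant $[f]_{Lip}$ with $|f(x,t)-f(y,t)|\le[f]_{Lip}\,d(x,y)$ for all $x,y\in E$, $t\ge0$. (2f) There is a constant $[G\widetilde Q]_{Lip}$ with $|G(x,t^\star(x))\widetilde Q(x,t^\star(x),y)-G(u,t^\star(u))\widetilde Q(u,t^\star(u),v)|\le[G\widetilde Q]_{Lip}\,d_2((x,y),(u,v))$ for all $x,y,u,v\in E$. **Notation.** $\nu$ is the unique invariant probability measure of the chain $(Z_n)_{n\ge0}$ (it exists under the assumptions, and $\nu(A)>0$ for every measurable $A$ with non-empty interior). For $x,y\in E$, $0\le t\le t^\star(x)$, $$H(x,y,t)=\int_t^{t^\star(x)}f(x,s)\widetilde Q(x,s,y)\,ds+G(x,t^\star(x))\widetilde Q(x,t^\star(x),y),$$ and for $0\le t<t^\star(A)$, $\widetilde H(A,B_k,t)=\frac1{\nu(A)}\int_{A\times B_k}H(x,y,t)\,\mu(dy)\,\nu(dx)$. The estimator is $$\widehat p_n(A,B_k,t)=\frac{\sum_{i=0}^{n-1}\mathbf{1}_{\{S_{i+1}>t\}}\mathbf{1}_{\{Z_{i+1}\in B_k\}}\mathbf{1}_{\{Z_i\in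 A\}}}{\sum_{i=0}^{n-1}\mathbf{1}_{\{Z_i\in A\}}}$$ (with $0/0=0$). *)

theory Defs
  imports "HOL-Probability.Probability"
begin

text \<open>
  The separable metric space is the type \<open>'a\<close> (for metric spaces, separable means second
  countable).  Functions of time are total on \<open>real\<close>, but only their values at nonnegative
  arguments are ever constrained or used; likewise functions of the state are only used on
  \<open>E\<close> or on its closure.
\<close>

definition hitting_time ::
  "'a::metric_space set \<Rightarrow> ('a \<Rightarrow> real \<Rightarrow> 'a) \<Rightarrow> 'a \<Rightarrow> ereal" where
  "hitting_time E \<Phi> \<xi> = Inf (ereal ` {t. 0 < t \<and> \<Phi> \<xi> t \<in> frontier E})"

definition hitting_time_set ::
  "'a::metric_space set \<Rightarrow> ('a \<Rightarrow> real \<Rightarrow> 'a) \<Rightarrow> 'a set \<Rightarrow> ereal" where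
  "hitting_time_set E \<Phi> A = (INF \<xi>\<in>A. hitting_time E \<Phi> \<xi>)"

definition tstar :: "'a::metric_space set \<Rightarrow> ('a \<Rightarrow> real \<Rightarrow> 'a) \<Rightarrow> 'a \<Rightarrow> real" where
  "tstar E \<Phi> \<xi> = real_of_ereal (hitting_time E \<Phi> \<xi>)"

locale pdmp =
  fixes E :: "'a::{metric_space, second_countable_topology} set"
    and \<Phi> :: "'a \<Rightarrow> real \<Rightarrow> 'a"
    and rate :: "'a \<Rightarrow> real"
    and Q :: "'a \<Rightarrow> 'a measure"
  assumes open_E: "open E"
    and nonempty_E: "E \<noteq> {}"
    and flow_measurable:
      "(\<lambda>(\<xi>, t). \<Phi> \<xi> t) \<in> restrict_space borel E \<Otimes>\<^sub>M restrict_space borel {0..}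
         \<rightarrow>\<^sub>M restrict_space borel (closure E)"
    and flow_semigroup:
      "\<lbrakk>\<xi> \<in> E; 0 \<le> t; 0 \<le> s; \<Phi> \<xi> t \<in> E\<rbrakk> \<Longrightarrow> \<Phi> \<xi> (t + s) = \<Phi> (\<Phi> \<xi> t) s"
    and hitting_time_measurable:
      "hitting_time E \<Phi> \<in> restrict_space borel E \<rightarrow>\<^sub>M borel"
    and rate_measurable: "rate \<in> restrict_space borel (closure E) \<rightarrow>\<^sub>M borel"
    and rate_nonneg: "\<xi> \<in> closure E \<Longrightarrow> 0 \<le> rate \<xi>"
    and rate_locally_integrable:
      "\<xi> \<in> E \<Longrightarrow> \<exists>\<epsilon>>0. (\<integral>\<^sup>+ s\<in>{0..\<epsilon>}. ennreal (rate (\<Phi> \<xi> s)) \<partial>lborel) < \<infinity>"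
    and kernel_Q:
      "Q \<in> restrict_space borel (closure E) \<rightarrow>\<^sub>M prob_algebra (restrict_space borel (closure E))"
    and Q_moves: "\<xi> \<in> closure E \<Longrightarrow> measure (Q \<xi>) (closure E - {\<xi>}) = 1"
    and Q_E: "\<xi> \<in> closure E \<Longrightarrow> measure (Q \<xi>) E = 1"

text \<open>
  \<open>surv\<close> and \<open>dens\<close> are the functions \<open>G\<close> and \<open>f\<close>; they ignore the boundary and are defined for
  all \<open>t \<ge> 0\<close>.
\<close>

definition surv :: "('a \<Rightarrow> real \<Rightarrow> 'a) \<Rightarrow> ('a \<Rightarrow> real) \<Rightarrow> 'a \<Rightarrow> real \<Rightarrow> real" where
  "surv \<Phi> rate \<xi> t = exp (- (LBINT s:{0..t}. rate (\<Phi> \<xi> s)))"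

definition dens :: "('a \<Rightarrow> real \<Rightarrow> 'a) \<Rightarrow> ('a \<Rightarrow> real) \<Rightarrow> 'a \<Rightarrow> real \<Rightarrow> real" where
  "dens \<Phi> rate \<xi> t = rate (\<Phi> \<xi> t) * surv \<Phi> rate \<xi> t"

text \<open>
  The probability \<open>P(S > t)\<close>, for \<open>t \<ge> 0\<close>, of an interarrival time \<open>S\<close> started from \<open>\<xi>\<close>: it is
  cut off at the (deterministic) time at which the flow reaches the boundary.
\<close>

definition interarrival_tail ::
  "'a::metric_space set \<Rightarrow> ('a \<Rightarrow> real \<Rightarrow> 'a) \<Rightarrow> ('a \<Rightarrow> real) \<Rightarrow> 'a \<Rightarrow> real \<Rightarrow> real" where
  "interarrival_tail E \<Phi> rate \<xi> t =
     (if ereal t < hitting_time E \<Phi> \<xi> then surv \<Phi> rate \<xi> t else 0)"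

definition history_gen ::
  "'w measure \<Rightarrow> (nat \<Rightarrow> 'w \<Rightarrow> 'a::topological_space) \<Rightarrow> (nat \<Rightarrow> 'w \<Rightarrow> real) \<Rightarrow> nat \<Rightarrow> 'w set set"
  where
  "history_gen M Z S n =
     (\<Union>i\<le>n. {Z i -` C \<inter> space M | C. C \<in> sets borel} \<union> {S i -` C \<inter> space M | C. C \<in> sets borel})"

definition history ::
  "'w measure \<Rightarrow> (nat \<Rightarrow> 'w \<Rightarrow> 'a::topological_space) \<Rightarrow> (nat \<Rightarrow> 'w \<Rightarrow> real) \<Rightarrow> nat \<Rightarrow> 'w measure"
  where
  "history M Z S n = sigma (space M) (history_gen M Z S n)"

definition history_next_time ::
  "'w measure \<Rightarrow> (nat \<Rightarrow> 'w \<Rightarrow> 'a::topological_space) \<Rightarrow> (nat \<Rightarrow> 'w \<Rightarrow> real) \<Rightarrow> nat \<Rightarrow> 'w measure"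
  where
  "history_next_time M Z S n =
     sigma (space M) (history_gen M Z S n \<union> {S (Suc n) -` C \<inter> space M | C. C \<in> sets borel})"

text \<open>
  Markovian dynamics expressed through conditional probabilities given the past.
  The underlying probability space is arbitrary; the initial law of \<open>Z\<^sub>0\<close> is not prescribed here.
\<close>

locale embedded_chain = prob_space M for M :: "'w measure" +
  fixes E :: "'a::{metric_space, second_countable_topology} set"
    and \<Phi> :: "'a \<Rightarrow> real \<Rightarrow> 'a"
    and rate :: "'a \<Rightarrow> real"
    and Q :: "'a \<Rightarrow> 'a measure"
    and Z :: "nat \<Rightarrow> 'w \<Rightarrow> 'a"
    and S :: "nat \<Rightarrow> 'w \<Rightarrow> real"
  assumes Z_measurable: "Z n \<in> M \<rightarrow>\<^sub>M restrict_space borel E"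
    and S_measurable: "S n \<in> M \<rightarrow>\<^sub>M restrict_space borel {0..}"
    and S_0: "AE \<omega> in M. S 0 \<omega> = 0"
    and cond_interarrival:
      "0 \<le> t \<Longrightarrow>
       AE \<omega> in M. real_cond_exp M (history M Z S n)
                      (indicator {\<omega>\<in>space M. t < S (Suc n) \<omega>}) \<omega>
                    = interarrival_tail E \<Phi> rate (Z n \<omega>) t"
    and cond_location:
      "C \<in> sets (restrict_space borel E) \<Longrightarrow>
       AE \<omega> in M. real_cond_exp M (history_next_time M Z S n)
                      (indicator {\<omega>\<in>space M. Z (Suc n) \<omega> \<in> C}) \<omega>
                    = measure (Q (\<Phi> (Z n \<omega>) (S (Suc n) \<omega>))) C"

text \<open>
  The law on \<open>real\<close> whose tail is \<^const>\<open>interarrival_tail\<close>, given by its distribution function;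
  it has an atom at the boundary hitting time.
\<close>

definition interarrival_law ::
  "'a::metric_space set \<Rightarrow> ('a \<Rightarrow> real \<Rightarrow> 'a) \<Rightarrow> ('a \<Rightarrow> real) \<Rightarrow> 'a \<Rightarrow> real measure" where
  "interarrival_law E \<Phi> rate \<xi> =
     interval_measure (\<lambda>t. if 0 \<le> t then 1 - interarrival_tail E \<Phi> rate \<xi> t else 0)"

definition chain_kernel ::
  "'a::metric_space set \<Rightarrow> ('a \<Rightarrow> real \<Rightarrow> 'a) \<Rightarrow> ('a \<Rightarrow> real) \<Rightarrow> ('a \<Rightarrow> 'a measure)
     \<Rightarrow> 'a \<Rightarrow> 'a set \<Rightarrow> ennreal" where
  "chain_kernel E \<Phi> rate Q \<xi> C =
     (\<integral>\<^sup>+ s\<in>{0..}. emeasure (Q (\<Phi> \<xi> s)) C \<partial>interarrival_law E \<Phi> rate \<xi>)"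

definition invariant_prob ::
  "'a::metric_space set \<Rightarrow> ('a \<Rightarrow> real \<Rightarrow> 'a) \<Rightarrow> ('a \<Rightarrow> real) \<Rightarrow> ('a \<Rightarrow> 'a measure)
     \<Rightarrow> 'a measure \<Rightarrow> bool" where
  "invariant_prob E \<Phi> rate Q \<nu> \<longleftrightarrow>
     prob_space \<nu> \<and> sets \<nu> = sets (restrict_space borel E) \<and>
     (\<forall>C\<in>sets (restrict_space borel E).
        (\<integral>\<^sup>+ \<xi>. chain_kernel E \<Phi> rate Q \<xi> C \<partial>\<nu>) = emeasure \<nu> C)"

definition class_C1 :: "'a::metric_space set \<Rightarrow> 'a set set" where
  "class_C1 E = {A \<in> sets borel. A \<subseteq> E \<and> interior A \<noteq> {}}"

definition class_C2 :: "'a::metric_space set \<Rightarrow> 'a set set" where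
  "class_C2 E = {A \<in> class_C1 E. compact (closure A) \<and> closure A \<inter> frontier E = {}}"

text \<open>
  Boundedness is required separately since \<^const>\<open>diameter\<close> is real-valued and meaningless for
  unbounded sets.
\<close>

definition admissible ::
  "'a::metric_space set \<Rightarrow> ('a \<Rightarrow> real \<Rightarrow> 'a) \<Rightarrow> ('a \<Rightarrow> 'a measure)
     \<Rightarrow> real \<Rightarrow> nat \<Rightarrow> (nat \<Rightarrow> 'a set) \<Rightarrow> bool" where
  "admissible E \<Phi> Q e p B \<longleftrightarrow>
     2 \<le> p \<and>
     (\<forall>k\<in>{1..p}. B k \<in> class_C1 E) \<and>
     disjoint_family_on B {1..p} \<and>
     (\<forall>k\<in>{1..p}. bounded (B k) \<and> diameter (B k) < e) \<and>
     (\<forall>k\<in>{1..p}. diameter (B k) \<le> diameter (B 1)) \<and>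
     (\<forall>x\<in>E. \<forall>t\<ge>0. (\<Sum>k=1..p. measure (Q (\<Phi> x t)) (B k)) = 1)"

locale regular_pdmp = pdmp E \<Phi> rate Q
  for E :: "'a::{metric_space, second_countable_topology} set"
    and \<Phi> :: "'a \<Rightarrow> real \<Rightarrow> 'a"
    and rate :: "'a \<Rightarrow> real"
    and Q :: "'a \<Rightarrow> 'a measure" +
  fixes \<mu> :: "'a measure"
    and q :: "'a \<Rightarrow> real \<Rightarrow> 'a \<Rightarrow> real"
  assumes sets_mu: "sets \<mu> = sets (restrict_space borel E)"
    and mu_pos: "\<lbrakk>C \<in> sets \<mu>; interior C \<noteq> {}\<rbrakk> \<Longrightarrow> 0 < emeasure \<mu> C"
    and q_measurable:
      "(\<lambda>(x, s, y). q x s y) \<in>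
         restrict_space borel E \<Otimes>\<^sub>M restrict_space borel {0..} \<Otimes>\<^sub>M restrict_space borel E \<rightarrow>\<^sub>M borel"
    and Q_density:
      "\<lbrakk>\<xi> \<in> E; 0 \<le> s; C \<in> sets \<mu>\<rbrakk> \<Longrightarrow>
         emeasure (Q (\<Phi> \<xi> s)) C = (\<integral>\<^sup>+ y\<in>C. ennreal (q \<xi> s y) \<partial>\<mu>)"
    and q_continuous: "\<lbrakk>x \<in> E; y \<in> E\<rbrakk> \<Longrightarrow> continuous_on {0..} (\<lambda>s. q x s y)"
    and q_lower_bound: "\<exists>m>0. \<forall>x\<in>E. \<forall>y\<in>E. \<forall>s\<ge>0. m \<le> q x s y"
    and partitions: "0 < e \<Longrightarrow> \<exists>p B. admissible E \<Phi> Q e p B"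
    and dens_pos: "\<lbrakk>\<xi> \<in> E; 0 \<le> t\<rbrakk> \<Longrightarrow> 0 < dens \<Phi> rate \<xi> t"
    and dens_continuous: "\<xi> \<in> E \<Longrightarrow> continuous_on {0..} (dens \<Phi> rate \<xi>)"
    and rate_dominated:
      "\<exists>M. (\<forall>t\<ge>0. 0 \<le> M t) \<and> (\<forall>T\<ge>0. set_integrable lborel {0..T} M) \<and>
           (\<forall>\<xi>\<in>E. \<forall>t\<ge>0. rate (\<Phi> \<xi> t) \<le> M t)"
    and hitting_time_bounded: "\<exists>c::real. \<forall>\<xi>\<in>E. hitting_time E \<Phi> \<xi> \<le> ereal c"
    and dens_q_lipschitz:
      "\<exists>L. \<forall>x\<in>E. \<forall>y\<in>E. \<forall>u\<in>E. \<forall>v\<in>E. \<forall>t.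
         0 \<le> t \<and> t < min (tstar E \<Phi> x) (tstar E \<Phi> u) \<longrightarrow>
         \<bar>dens \<Phi> rate x t * q x t y - dens \<Phi> rate u t * q u t v\<bar> \<le> L * (dist x u + dist y v)"
    and dens_lipschitz:
      "\<exists>L. \<forall>x\<in>E. \<forall>y\<in>E. \<forall>t\<ge>0. \<bar>dens \<Phi> rate x t - dens \<Phi> rate y t\<bar> \<le> L * dist x y"
    and surv_q_lipschitz:
      "\<exists>L. \<forall>x\<in>E. \<forall>y\<in>E. \<forall>u\<in>E. \<forall>v\<in>E.
         \<bar>surv \<Phi> rate x (tstar E \<Phi> x) * q x (tstar E \<Phi> x) y
            - surv \<Phi> rate u (tstar E \<Phi> u) * q u (tstar E \<Phi> u) v\<bar> \<le> L * (dist x u + dist y v)"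

definition H_fun ::
  "'a::metric_space set \<Rightarrow> ('a \<Rightarrow> real \<Rightarrow> 'a) \<Rightarrow> ('a \<Rightarrow> real) \<Rightarrow> ('a \<Rightarrow> real \<Rightarrow> 'a \<Rightarrow> real)
     \<Rightarrow> 'a \<Rightarrow> 'a \<Rightarrow> real \<Rightarrow> real" where
  "H_fun E \<Phi> rate q x y t =
     (LBINT s:{t..tstar E \<Phi> x}. dens \<Phi> rate x s * q x s y)
       + surv \<Phi> rate x (tstar E \<Phi> x) * q x (tstar E \<Phi> x) y"

definition H_tilde ::
  "'a::metric_space set \<Rightarrow> ('a \<Rightarrow> real \<Rightarrow> 'a) \<Rightarrow> ('a \<Rightarrow> real) \<Rightarrow> ('a \<Rightarrow> real \<Rightarrow> 'a \<Rightarrow> real)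
     \<Rightarrow> 'a measure \<Rightarrow> 'a measure \<Rightarrow> 'a set \<Rightarrow> 'a set \<Rightarrow> real \<Rightarrow> real" where
  "H_tilde E \<Phi> rate q \<mu> \<nu> A B t =
     1 / measure \<nu> A *
       set_lebesgue_integral (\<nu> \<Otimes>\<^sub>M \<mu>) (A \<times> B) (\<lambda>(x, y). H_fun E \<Phi> rate q x y t)"

text \<open>The estimator uses the convention \<open>0 / 0 = 0\<close>, which is that of HOL.\<close>

definition p_hat ::
  "(nat \<Rightarrow> 'w \<Rightarrow> 'a) \<Rightarrow> (nat \<Rightarrow> 'w \<Rightarrow> real) \<Rightarrow> nat \<Rightarrow> 'a set \<Rightarrow> 'a set \<Rightarrow> real \<Rightarrow> 'w \<Rightarrow> real"
  where
  "p_hat Z S n A B t \<omega> =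
     (\<Sum>i<n. indicator {t<..} (S (Suc i) \<omega>) * indicator B (Z (Suc i) \<omega>) * indicator A (Z i \<omega>))
       / (\<Sum>i<n. indicator A (Z i \<omega>))"

end

theory Submission
  imports Defs "HOL-Library.Discrete_Functions"
begin

text \<open>
  The lower bound on \<open>q\<close> makes \<open>m \<mu>\<close> a common minorant of all transition probabilities of \<open>(Z\<^sub>n)\<close>
  (Doeblin's condition), so the iterates \<open>K\<^sup>j g\<close> of a bounded function \<open>g\<close> converge uniformly to
  \<open>\<integral> g d\<nu>\<close>.  For bounded martingale differences the averages tend to \<open>0\<close> almost surely, by the second
  moment bound along squares.  Hence the averages of \<open>g(Z\<^sub>i)\<close> and of \<open>(K\<^sup>j g)(Z\<^sub>i)\<close> have the same limit for every \<open>j\<close>,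
  and this limit is \<open>\<integral> g d\<nu>\<close>, whatever the initial law.  The same martingale argument replaces the
  numerator of the estimator by the average of the conditional probabilities
  \<open>1\<^sub>A(Z\<^sub>i) P(S\<^bsub>i+1\<^esub> > s, Z\<^bsub>i+1\<^esub> \<in> B | Z\<^sub>i)\<close>, whose \<open>\<nu>\<close>-mean is \<open>\<nu>(A) H(A, B, s)\<close> because the interarrival law
  has density \<open>f\<close> before \<open>t\<^sup>\<star>\<close> and an atom of mass \<open>G(t\<^sup>\<star>)\<close> at \<open>t\<^sup>\<star>\<close>.  Convergence for fixed \<open>s\<close> becomes
  uniform since the estimator is decreasing in \<open>s\<close> and the limit is continuous.
\<close>

section \<open>A law of large numbers for bounded martingale differences\<close>

text \<open>The chain is known only through almost sure identities, one for each tail {S > t} and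
  each set C. Conditional expectations of functions of Z_n and S_(n+1) must therefore be recovered
  from such a generating family, which is the role of
  \<open>real_cond_exp_eq_kernel_integral\<close>. The minorant is uniform in the state, so one
  application of K shrinks the oscillation of g by a fixed factor below 1, whatever the current
  state; this is why P_x needs no comparison with the stationary chain. The interarrival law from x
  has an atom at \<open>ts x\<close>, and the limit could jump there. A time t below the hitting
  time of A keeps [0, t] clear of the atoms of all x in A. The function of
  \<open>rate_dominated\<close> then gives one modulus of continuity for all states, which survives
  the average over \<open>\<nu>\<close>. Uncountably many s also mean uncountably many null sets;
  hence almost sure convergence is used only on a countable grid, and monotonicity fills the
  gaps.\<close>

lemma (in prob_space) slln_bounded_uncorrelated:
  fixes D :: "nat \<Rightarrow> 'a \<Rightarrow> real"
  assumes D[measurable]: "\<And>i. D i \<in> borel_measurable M"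
    and bound: "\<And>i. AE x in M. \<bar>D i x\<bar> \<le> c"
    and uncorr: "\<And>i j. i < j \<Longrightarrow> expectation (\<lambda>x. D i x * D j x) = 0"
  shows "AE x in M. (\<lambda>n. (\<Sum>i<n. D i x) / real n) \<longlonglongrightarrow> 0"
proof -
  have "AE x in M. 0 \<le> c"
    using bound[of 0] by eventually_elim linarith
  then have c: "0 \<le> c" by simp
  have all_bound: "AE x in M. \<forall>i. \<bar>D i x\<bar> \<le> c"
    using bound by (simp add: AE_all_countable)
  define m where "m n x = (\<Sum>i<n. D i x)" for n x
  have [measurable]: "m n \<in> borel_measurable M" for n
    unfolding m_def by measurable
  have intDD: "integrable M (\<lambda>x. D i x * D j x)" for i j
  proof (rule integrable_const_bound[of _ "c * c"])
    show "AE x in M. norm (D i x * D j x) \<le> c * c"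
      using all_bound by eventually_elim (auto simp: abs_mult intro!: mult_mono)
  qed simp
  \<comment> \<open>The cross terms have mean zero, so each step adds at most c^2 to the second
    moment of the partial sum.\<close>
  have m_sq: "integrable M (\<lambda>x. (m n x)\<^sup>2) \<and> expectation (\<lambda>x. (m n x)\<^sup>2) \<le> real n * c\<^sup>2" for n
  proof (induction n)
    case 0
    then show ?case by (simp add: m_def)
  next
    case (Suc n)
    have eq: "(m (Suc n) x)\<^sup>2 = (m n x)\<^sup>2 + 2 * (\<Sum>i<n. D i x * D n x) + D n x * D n x" for x
      by (simp add: m_def power2_sum power2_eq_square sum_distrib_right[symmetric] algebra_simps)
    have i1: "integrable M (\<lambda>x. \<Sum>i<n. D i x * D n x)"
      using intDD by simp
    have "expectation (\<lambda>x. (m (Suc n) x)\<^sup>2) =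
        expectation (\<lambda>x. (m n x)\<^sup>2) + 2 * expectation (\<lambda>x. \<Sum>i<n. D i x * D n x)
        + expectation (\<lambda>x. D n x * D n x)"
      unfolding eq using Suc i1 intDD[of n n] by simp
    also have "expectation (\<lambda>x. \<Sum>i<n. D i x * D n x) = 0"
      using intDD uncorr by (subst Bochner_Integration.integral_sum) auto
    also have "expectation (\<lambda>x. D n x * D n x) \<le> expectation (\<lambda>_. c * c)"
    proof (rule integral_mono_AE)
      show "AE x in M. D n x * D n x \<le> c * c"
        using all_bound
        by eventually_elim (metis abs_ge_zero abs_mult_self_eq c mult_mono)
    qed (use intDD in auto)
    finally have "expectation (\<lambda>x. (m (Suc n) x)\<^sup>2) \<le> real (Suc n) * c\<^sup>2"
      using Suc by (simp add: power2_eq_square prob_space algebra_simps)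
    moreover have "integrable M (\<lambda>x. (m (Suc n) x)\<^sup>2)"
      unfolding eq using Suc i1 intDD[of n n] by simp
    ultimately show ?case by blast
  qed
  \<comment> \<open>Along n = k^2 the second moment of the average is at most c^2 / k^2, which is
    summable; the bound c^2 / n over all n is not. At k = 0 the quotient is 0 by convention.\<close>
  define X where "X k x = (m (k\<^sup>2) x / real (k\<^sup>2))\<^sup>2" for k x
  have [measurable]: "X k \<in> borel_measurable M" for k
    unfolding X_def by measurable
  have EX: "(\<integral>\<^sup>+x. ennreal (X k x) \<partial>M) \<le> ennreal (c\<^sup>2 * inverse (real k ^ 2))" for k
  proof -
    have "(\<integral>\<^sup>+x. ennreal (X k x) \<partial>M) = ennreal (expectation (\<lambda>x. X k x))"
      using m_sq[of "k\<^sup>2"] unfolding X_def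
      by (intro nn_integral_eq_integral) (auto simp: power_divide)
    also have "expectation (\<lambda>x. X k x) = expectation (\<lambda>x. (m (k\<^sup>2) x)\<^sup>2) / (real (k\<^sup>2))\<^sup>2"
      by (simp add: X_def power_divide)
    also have "\<dots> \<le> (real (k\<^sup>2) * c\<^sup>2) / (real (k\<^sup>2))\<^sup>2"
      using m_sq[of "k\<^sup>2"] by (intro divide_right_mono) auto
    also have "\<dots> = c\<^sup>2 * inverse (real k ^ 2)"
      by (cases "k = 0") (simp_all add: power2_eq_square field_simps)
    finally show ?thesis by (simp add: ennreal_leI)
  qed
  have "(\<integral>\<^sup>+x. (\<Sum>k. ennreal (X k x)) \<partial>M) = (\<Sum>k. \<integral>\<^sup>+x. ennreal (X k x) \<partial>M)"
    by (rule nn_integral_suminf) measurable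
  also have "\<dots> \<le> (\<Sum>k. ennreal (c\<^sup>2 * inverse (real k ^ 2)))"
    by (intro suminf_le EX) auto
  also have "\<dots> < \<infinity>"
  proof -
    have "summable (\<lambda>k. c\<^sup>2 * inverse (real k ^ 2))"
      by (intro summable_mult inverse_power_summable) auto
    then have "(\<Sum>k. ennreal (c\<^sup>2 * inverse (real k ^ 2)))
        = ennreal (\<Sum>k. c\<^sup>2 * inverse (real k ^ 2))"
      by (intro suminf_ennreal2) auto
    then show ?thesis by (metis ennreal_less_top infinity_ennreal_def)
  qed
  finally have "AE x in M. (\<Sum>k. ennreal (X k x)) \<noteq> \<infinity>"
    by (intro nn_integral_PInf_AE) auto
  then show ?thesis
    using all_bound
  proof eventually_elim
    case (elim x)
    have "summable (\<lambda>k. X k x)"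
      using elim(1) by (intro summable_suminf_not_top) (auto simp: X_def)
    then have "(\<lambda>k. X k x) \<longlonglongrightarrow> 0"
      by (rule summable_LIMSEQ_zero)
    then have "(\<lambda>k. sqrt (X k x)) \<longlonglongrightarrow> sqrt 0"
      by (rule tendsto_real_sqrt)
    then have lim1: "(\<lambda>k. \<bar>m (k\<^sup>2) x\<bar> / real (k\<^sup>2)) \<longlonglongrightarrow> 0"
      by (simp add: X_def abs_divide)
    have "(\<lambda>k. 2 * c * inverse (real k)) \<longlonglongrightarrow> 2 * c * 0"
      by (intro tendsto_intros lim_inverse_n)
    with lim1 have lim2: "(\<lambda>k. \<bar>m (k\<^sup>2) x\<bar> / real (k\<^sup>2) + 2 * c * inverse (real k)) \<longlonglongrightarrow> 0"
      by (auto intro: tendsto_add_zero)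
    \<comment> \<open>Each n is compared with the largest square not exceeding it; since
      \<open>floor_sqrt\<close> tends to infinity, limits in k become limits in n.\<close>
    have "filterlim floor_sqrt sequentially sequentially"
      unfolding filterlim_at_top
      by (auto simp: le_floor_sqrt_iff eventually_sequentially)
    from filterlim_compose[OF lim2 this]
    have lim3: "(\<lambda>n. \<bar>m ((floor_sqrt n)\<^sup>2) x\<bar> / real ((floor_sqrt n)\<^sup>2)
        + 2 * c * inverse (real (floor_sqrt n))) \<longlonglongrightarrow> 0" .
    show "(\<lambda>n. (\<Sum>i<n. D i x) / real n) \<longlonglongrightarrow> 0"
    proof (rule Lim_null_comparison[OF _ lim3])
      show "\<forall>\<^sub>F n in sequentially. norm ((\<Sum>i<n. D i x) / real n)
        \<le> \<bar>m ((floor_sqrt n)\<^sup>2) x\<bar> / real ((floor_sqrt n)\<^sup>2) + 2 * c * inverse (real (floor_sqrt n))"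
        using eventually_gt_at_top[of 0]
      proof eventually_elim
        case (elim n)
        define k where "k = floor_sqrt n"
        have k: "0 < k" "k\<^sup>2 \<le> n" "n < (Suc k)\<^sup>2"
          using elim Suc_floor_sqrt_power2_gt[of n] by (auto simp: k_def)
        \<comment> \<open>As n < (k + 1)^2, at most 2k terms follow the first k^2, each at most c.
          Divided by n >= k^2 they contribute at most 2c / k.\<close>
        have nk: "n - k\<^sup>2 \<le> 2 * k"
          using k(3) by (simp add: power2_eq_square)
        have "m n x = m (k\<^sup>2) x + (\<Sum>i\<in>{k\<^sup>2..<n}. D i x)"
          unfolding m_def using k(2)
          by (metis atLeast0LessThan sum.atLeastLessThan_concat zero_le)
        moreover have "\<bar>\<Sum>i\<in>{k\<^sup>2..<n}. D i x\<bar> \<le> (\<Sum>i\<in>{k\<^sup>2..<n}. c)"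
          using \<open>\<forall>i. \<bar>D i x\<bar> \<le> c\<close> by (intro order_trans[OF sum_abs] sum_mono) auto
        moreover have "(\<Sum>i\<in>{k\<^sup>2..<n}. c) \<le> (2 * real k) * c"
          using nk c by (auto intro!: mult_right_mono)
        ultimately have "\<bar>m n x\<bar> \<le> \<bar>m (k\<^sup>2) x\<bar> + 2 * real k * c"
          by linarith
        then have "\<bar>m n x\<bar> / real n \<le> (\<bar>m (k\<^sup>2) x\<bar> + 2 * real k * c) / real n"
          by (intro divide_right_mono) auto
        also have "\<dots> \<le> (\<bar>m (k\<^sup>2) x\<bar> + 2 * real k * c) / real (k\<^sup>2)"
          using k c elim by (intro divide_left_mono mult_pos_pos) (auto simp del: of_nat_power)
        also have "\<dots> = \<bar>m (k\<^sup>2) x\<bar> / real (k\<^sup>2) + 2 * c * inverse (real k)"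
          using k by (simp add: field_simps power2_eq_square)
        finally show ?case
          by (simp add: m_def k_def abs_divide)
      qed
    qed
  qed
qed

text \<open>For i < j the difference with index i is measurable for \<open>F j\<close>, while the
  one with index j has conditional mean zero given \<open>F j\<close>; so their product has mean
  zero and the uncorrelated case applies.\<close>

lemma (in prob_space) slln_bounded_martingale_differences:
  fixes Y :: "nat \<Rightarrow> 'a \<Rightarrow> real"
  assumes sub: "\<And>i. subalgebra M (F i)"
    and mono: "\<And>i j. i \<le> j \<Longrightarrow> sets (F i) \<subseteq> sets (F j)"
    and Y: "\<And>i. Y i \<in> borel_measurable (F (Suc i))"
    and bound: "\<And>i x. x \<in> space M \<Longrightarrow> \<bar>Y i x\<bar> \<le> c"
  shows "AE x in M. (\<lambda>n. (\<Sum>i<n. Y i x - real_cond_exp M (F i) (Y i) x) / real n) \<longlonglongrightarrow> 0"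
proof (rule slln_bounded_uncorrelated)
  have sf: "sigma_finite_subalgebra M (F i)" for i
    by (intro finite_measure_subalgebra_is_sigma_finite finite_measure_subalgebra.intro
        finite_measure_subalgebra_axioms.intro sub) unfold_locales
  have YM[measurable]: "Y i \<in> borel_measurable M" for i
    by (rule measurable_from_subalg[OF sub Y])
  have intY: "integrable M (Y i)" for i
    using bound by (intro integrable_const_bound[of _ c]) auto
  have Fmeas: "real_cond_exp M (F i) (Y i) \<in> borel_measurable (F j)" if "i \<le> j" for i j
  proof (rule measurable_from_subalg)
    show "subalgebra (F j) (F i)"
      using sub mono[OF that] by (auto simp: subalgebra_def)
  qed (rule borel_measurable_cond_exp)
  have YF: "Y i \<in> borel_measurable (F j)" if "i < j" for i j
  proof (rule measurable_from_subalg)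
    show "subalgebra (F j) (F (Suc i))"
      using sub mono[of "Suc i" j] that by (auto simp: subalgebra_def)
  qed (rule Y)
  show [measurable]: "(\<lambda>x. Y i x - real_cond_exp M (F i) (Y i) x) \<in> borel_measurable M" for i
    by measurable
  \<comment> \<open>Bounds pass to conditional expectations only almost everywhere; this is the
    reason for the almost everywhere bound assumed in the uncorrelated case.\<close>
  have ce_bound: "AE x in M. \<bar>real_cond_exp M (F i) (Y i) x\<bar> \<le> c" for i
  proof -
    interpret sigma_finite_subalgebra M "F i" by (rule sf)
    have "AE x in M. real_cond_exp M (F i) (Y i) x \<le> c"
      using bound intY by (intro real_cond_exp_le_c) (auto simp: abs_le_iff)
    moreover have "AE x in M. - c \<le> real_cond_exp M (F i) (Y i) x"
      using bound intY by (intro real_cond_exp_ge_c) (auto simp: abs_le_iff minus_le_iff)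
    ultimately show ?thesis by eventually_elim auto
  qed
  show D_bound: "AE x in M. \<bar>Y i x - real_cond_exp M (F i) (Y i) x\<bar> \<le> 2 * c" for i
    using ce_bound[of i] AE_space[of M]
  proof eventually_elim
    case (elim x)
    then show ?case using bound[of x i] by linarith
  qed
  show "expectation (\<lambda>x. (Y i x - real_cond_exp M (F i) (Y i) x)
      * (Y j x - real_cond_exp M (F j) (Y j) x)) = 0" if "i < j" for i j
  proof -
    interpret sigma_finite_subalgebra M "F j" by (rule sf)
    let ?D = "\<lambda>x. Y i x - real_cond_exp M (F i) (Y i) x"
    have DF: "?D \<in> borel_measurable (F j)"
      using that by (intro borel_measurable_diff YF Fmeas) auto
    have int: "integrable M (\<lambda>x. ?D x * Y j x)"
    proof (rule integrable_const_bound[of _ "2 * c * c"])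
      show "AE x in M. norm (?D x * Y j x) \<le> 2 * c * c"
        using D_bound[of i] AE_space[of M]
      proof eventually_elim
        case (elim x)
        then show ?case
          unfolding real_norm_def abs_mult using bound[of x j] by (intro mult_mono) auto
      qed
    qed simp
    show ?thesis
      using real_cond_exp_intg[OF int DF] int
      by (simp add: right_diff_distrib)
  qed
qed

section \<open>Markov chains under a Doeblin condition\<close>

text \<open>For A in F, the law of (X, Y) restricted to A and the mixture over A of the laws of (x,
  y) with x = X and y drawn from \<open>T x\<close> agree on rectangles with second side in G. Such
  rectangles are intersection-stable and generate, so the two measures are equal, and \<psi> can be
  integrated against this equality. Knowledge on a generator G must suffice because interarrival
  times are described by their tails alone.\<close>

lemma (in prob_space) real_cond_exp_eq_kernel_integral:
  fixes \<psi> :: "'b \<Rightarrow> 'c \<Rightarrow> real"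
  assumes sub: "subalgebra M F"
    and X[measurable]: "X \<in> F \<rightarrow>\<^sub>M N"
    and Y[measurable]: "Y \<in> M \<rightarrow>\<^sub>M L"
    and T[measurable]: "T \<in> N \<rightarrow>\<^sub>M prob_algebra L"
    and G: "Int_stable G" "G \<subseteq> Pow (space L)" "space L \<in> G" "sets L = sigma_sets (space L) G"
    and cond: "\<And>C. C \<in> G \<Longrightarrow>
      AE \<omega> in M. real_cond_exp M F (\<lambda>\<omega>. indicator C (Y \<omega>)) \<omega> = measure (T (X \<omega>)) C"
    and \<psi>[measurable]: "(\<lambda>(x, y). \<psi> x y) \<in> borel_measurable (N \<Otimes>\<^sub>M L)"
    and bound: "\<And>x y. x \<in> space N \<Longrightarrow> y \<in> space L \<Longrightarrow> \<bar>\<psi> x y\<bar> \<le> c"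
  shows "AE \<omega> in M. real_cond_exp M F (\<lambda>\<omega>. \<psi> (X \<omega>) (Y \<omega>)) \<omega> = (\<integral>y. \<psi> (X \<omega>) y \<partial>T (X \<omega>))"
proof -
  interpret fs: finite_measure_subalgebra M F
    by (simp add: finite_measure_subalgebra.intro finite_measure_subalgebra_axioms.intro
        finite_measure_axioms sub)
  have XM[measurable]: "X \<in> M \<rightarrow>\<^sub>M N" by (rule measurable_from_subalg[OF sub X])
  have Tp: "prob_space (T x)" "sets (T x) = sets L" "space (T x) = space L" if "x \<in> space N" for x
    using measurable_space[OF T that] by (auto simp: space_prob_algebra dest: sets_eq_imp_space_eq)
  have Xs: "X \<omega> \<in> space N" if "\<omega> \<in> space M" for \<omega>
    using measurable_space[OF XM that] .
  have Tsub[measurable]: "T \<in> N \<rightarrow>\<^sub>M subprob_algebra L"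
    by (rule measurable_prob_algebraD[OF T])
  \<comment> \<open>\<open>J x\<close> is the point mass at x times \<open>T x\<close>, carried on
    the product space so that \<psi> becomes a function of one variable.\<close>
  define J where "J x = distr (T x) (N \<Otimes>\<^sub>M L) (Pair x)" for x
  have J[measurable]: "J \<in> N \<rightarrow>\<^sub>M subprob_algebra (N \<Otimes>\<^sub>M L)"
    unfolding J_def by (rule measurable_distr2[of _ _ L]) auto
  have GL: "C \<in> sets L" if "C \<in> G" for C
    using that by (simp add: G(4))
  \<comment> \<open>Generating a product from rectangles requires each generator to cover its space;
    this uses that \<open>space L\<close> belongs to G.\<close>
  have gen: "sets (N \<Otimes>\<^sub>M L) = sigma_sets (space N \<times> space L) {a \<times> b |a b. a \<in> sets N \<and> b \<in> G}"
  proof -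
    have "sets (N \<Otimes>\<^sub>M L) = sets (sigma (space N) (sets N) \<Otimes>\<^sub>M sigma (space L) G)"
      by (intro sets_pair_measure_cong) (auto simp: G(2,4) sets.space_closed sets.sigma_sets_eq)
    also have "sigma (space N) (sets N) \<Otimes>\<^sub>M sigma (space L) G
        = sigma (space N \<times> space L) {a \<times> b |a b. a \<in> sets N \<and> b \<in> G}"
      by (rule sigma_prod)
        (use G(2,3) in \<open>auto simp: sets.space_closed intro!: exI[of _ "{space N}"] exI[of _ "{space L}"]\<close>)
    also have "sets \<dots> = sigma_sets (space N \<times> space L) {a \<times> b |a b. a \<in> sets N \<and> b \<in> G}"
      using G(2) sets.sets_into_space by (intro sets_measure_of) fastforce
    finally show ?thesis .
  qed
  have \<psi>_J: "(\<integral>z. case_prod \<psi> z \<partial>J x) = (\<integral>y. \<psi> x y \<partial>T x)" if "x \<in> space N" for x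
    unfolding J_def using that Tp by (subst integral_distr) (auto cong: measurable_cong_sets)
  have "(\<lambda>x. \<integral>z. case_prod \<psi> z \<partial>J x) \<in> borel_measurable N"
    using measurable_compose[OF J integral_measurable_subprob_algebra[OF \<psi>]] .
  then have \<psi>_int: "(\<lambda>x. \<integral>y. \<psi> x y \<partial>T x) \<in> borel_measurable N"
    by (rule measurable_cong[THEN iffD1, rotated]) (rule \<psi>_J)
  show ?thesis
  proof (rule fs.real_cond_exp_charact)
    show "integrable M (\<lambda>\<omega>. \<psi> (X \<omega>) (Y \<omega>))"
      using bound Xs measurable_space[OF Y]
      by (intro integrable_const_bound[of _ c]) auto
    show meas: "(\<lambda>\<omega>. \<integral>y. \<psi> (X \<omega>) y \<partial>T (X \<omega>)) \<in> borel_measurable F"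
      using measurable_compose[OF X \<psi>_int] .
    have int_bound: "\<bar>\<integral>y. \<psi> (X \<omega>) y \<partial>T (X \<omega>)\<bar> \<le> c" if \<omega>: "\<omega> \<in> space M" for \<omega>
    proof -
      interpret T: prob_space "T (X \<omega>)" using Tp Xs[OF \<omega>] by auto
      have m: "\<psi> (X \<omega>) \<in> borel_measurable (T (X \<omega>))"
        using Xs[OF \<omega>] Tp by (simp cong: measurable_cong_sets)
      have i: "integrable (T (X \<omega>)) (\<lambda>y. \<psi> (X \<omega>) y)"
        using bound Xs[OF \<omega>] Tp m by (intro T.integrable_const_bound[of _ c]) auto
      have "\<bar>\<integral>y. \<psi> (X \<omega>) y \<partial>T (X \<omega>)\<bar> \<le> (\<integral>y. \<bar>\<psi> (X \<omega>) y\<bar> \<partial>T (X \<omega>))"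
        by (rule integral_abs_bound)
      also have "\<dots> \<le> (\<integral>y. c \<partial>T (X \<omega>))"
        using bound Xs[OF \<omega>] Tp i by (intro integral_mono) auto
      finally show ?thesis by (simp add: T.prob_space)
    qed
    show "integrable M (\<lambda>\<omega>. \<integral>y. \<psi> (X \<omega>) y \<partial>T (X \<omega>))"
      using int_bound measurable_from_subalg[OF sub meas]
      by (intro integrable_const_bound[of _ c]) auto
    fix A assume A: "A \<in> sets F"
    then have AM[measurable]: "A \<in> sets M" using sub by (auto simp: subalgebra_def)
    \<comment> \<open>The restriction of M to A: integrals over A in the characterisation of
      conditional expectation become integrals against a finite measure.\<close>
    define MA where "MA = density M (indicator A)"
    have MA_sets[simp, measurable_cong]: "sets MA = sets M" and MA_space[simp]: "space MA = space M"
      by (simp_all add: MA_def)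
    have "emeasure MA (space M) \<le> 1"
      unfolding MA_def by (subst emeasure_density) (auto simp: nn_integral_indicator emeasure_le_1)
    then interpret MA: finite_measure MA
      by (intro finite_measureI) (auto simp: top_unique)
    have MA_ne: "space MA \<noteq> {}" using not_empty by simp
    have eq: "distr MA (N \<Otimes>\<^sub>M L) (\<lambda>\<omega>. (X \<omega>, Y \<omega>)) = MA \<bind> (\<lambda>\<omega>. J (X \<omega>))"
    proof (rule measure_eqI_generator_eq)
      show "Int_stable {a \<times> b |a b. a \<in> sets N \<and> b \<in> G}"
        using G(1) by (auto simp: Int_stable_def Times_Int_Times) blast
      show "{a \<times> b |a b. a \<in> sets N \<and> b \<in> G} \<subseteq> Pow (space N \<times> space L)"
        using G(2) sets.sets_into_space by fastforce
      show "sets (distr MA (N \<Otimes>\<^sub>M L) (\<lambda>\<omega>. (X \<omega>, Y \<omega>)))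
          = sigma_sets (space N \<times> space L) {a \<times> b |a b. a \<in> sets N \<and> b \<in> G}"
        by (simp add: gen)
      have JX: "(\<lambda>\<omega>. J (X \<omega>)) \<in> MA \<rightarrow>\<^sub>M subprob_algebra (N \<Otimes>\<^sub>M L)"
        by measurable
      show "sets (MA \<bind> (\<lambda>\<omega>. J (X \<omega>)))
          = sigma_sets (space N \<times> space L) {a \<times> b |a b. a \<in> sets N \<and> b \<in> G}"
        using sets_bind[OF sets_kernel[OF JX] MA_ne] by (simp add: gen)
      show "range (\<lambda>_::nat. space N \<times> space L) \<subseteq> {a \<times> b |a b. a \<in> sets N \<and> b \<in> G}"
        using G(3) by auto
      show "(\<Union>i::nat. space N \<times> space L) = space N \<times> space L" by simp
      show "emeasure (distr MA (N \<Otimes>\<^sub>M L) (\<lambda>\<omega>. (X \<omega>, Y \<omega>))) (space N \<times> space L) \<noteq> \<infinity>" for i :: nat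
        using MA.emeasure_finite by (subst emeasure_distr) (auto simp: space_pair_measure)
      fix R assume "R \<in> {a \<times> b |a b. a \<in> sets N \<and> b \<in> G}"
      then obtain a b where R: "R = a \<times> b" and a[measurable]: "a \<in> sets N" and bG: "b \<in> G" by auto
      note b[measurable] = GL[OF bG]
      \<comment> \<open>Because this factor is measurable for F, Y may be replaced by its
        conditional probability under the integral, where \<open>cond\<close> applies.\<close>
      have ind: "(\<lambda>\<omega>. indicator (X -` a \<inter> A) \<omega> :: real) \<in> borel_measurable F"
      proof -
        have "X -` a \<inter> A = (X -` a \<inter> space F) \<inter> A"
          using A sets.sets_into_space by blast
        then have "X -` a \<inter> A \<in> sets F"
          using A measurable_sets[OF X a] by auto
        then show ?thesis by simp
      qed
      have Xa[measurable]: "X -` a \<inter> A \<in> sets M"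
      proof -
        have "X -` a \<inter> A = (X -` a \<inter> space M) \<inter> A"
          using AM sets.sets_into_space by blast
        then show ?thesis using measurable_sets[OF XM a] AM by auto
      qed
      have R_m: "R \<in> sets (N \<Otimes>\<^sub>M L)" by (simp add: R)
      have "emeasure (distr MA (N \<Otimes>\<^sub>M L) (\<lambda>\<omega>. (X \<omega>, Y \<omega>))) R
          = emeasure MA ((\<lambda>\<omega>. (X \<omega>, Y \<omega>)) -` R \<inter> space M)"
        using R_m by (subst emeasure_distr) auto
      also have "\<dots> = (\<integral>\<^sup>+\<omega>. indicator A \<omega> * indicator ((\<lambda>\<omega>. (X \<omega>, Y \<omega>)) -` R \<inter> space M) \<omega> \<partial>M)"
        unfolding MA_def using R_m by (subst emeasure_density) auto
      also have "\<dots> = (\<integral>\<^sup>+\<omega>. ennreal (indicator (X -` a \<inter> A) \<omega> * indicator b (Y \<omega>)) \<partial>M)"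
        by (intro nn_integral_cong) (auto simp: R split: split_indicator)
      also have "\<dots> = ennreal (\<integral>\<omega>. indicator (X -` a \<inter> A) \<omega> * indicator b (Y \<omega>) \<partial>M)"
        by (intro nn_integral_eq_integral integrable_const_bound[of _ 1])
          (auto split: split_indicator)
      also have "(\<integral>\<omega>. indicator (X -` a \<inter> A) \<omega> * indicator b (Y \<omega>) \<partial>M)
          = (\<integral>\<omega>. indicator (X -` a \<inter> A) \<omega> * real_cond_exp M F (\<lambda>\<omega>. indicator b (Y \<omega>)) \<omega> \<partial>M)"
        by (intro fs.real_cond_exp_intg(2)[symmetric] ind integrable_const_bound[of _ 1])
          (auto split: split_indicator)
      also have "\<dots> = (\<integral>\<omega>. indicator (X -` a \<inter> A) \<omega> * measure (T (X \<omega>)) b \<partial>M)"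
        using cond[OF bG] by (intro integral_cong_AE) auto
      also have "ennreal \<dots> = (\<integral>\<^sup>+\<omega>. ennreal (indicator (X -` a \<inter> A) \<omega> * measure (T (X \<omega>)) b) \<partial>M)"
        using Tp Xs
        by (intro nn_integral_eq_integral[symmetric] integrable_const_bound[of _ 1])
          (auto split: split_indicator intro!: prob_space.prob_le_1)
      also have "\<dots> = (\<integral>\<^sup>+\<omega>. indicator A \<omega> * emeasure (J (X \<omega>)) R \<partial>M)"
      proof (intro nn_integral_cong)
        fix \<omega> assume \<omega>: "\<omega> \<in> space M"
        interpret T: prob_space "T (X \<omega>)" using Tp Xs[OF \<omega>] by auto
        have "emeasure (J (X \<omega>)) R = emeasure (T (X \<omega>)) (Pair (X \<omega>) -` R \<inter> space (T (X \<omega>)))"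
          unfolding J_def using R_m Xs[OF \<omega>] Tp by (subst emeasure_distr) (auto cong: measurable_cong_sets)
        also have "Pair (X \<omega>) -` R \<inter> space (T (X \<omega>)) = (if X \<omega> \<in> a then b else {})"
          using sets.sets_into_space[OF b] Tp Xs[OF \<omega>] by (auto simp: R)
        finally show "ennreal (indicator (X -` a \<inter> A) \<omega> * measure (T (X \<omega>)) b)
            = indicator A \<omega> * emeasure (J (X \<omega>)) R"
          by (auto simp: T.emeasure_eq_measure split: split_indicator)
      qed
      also have "\<dots> = (\<integral>\<^sup>+\<omega>. emeasure (J (X \<omega>)) R \<partial>MA)"
        unfolding MA_def using R_m by (subst nn_integral_density) auto
      also have "\<dots> = emeasure (MA \<bind> (\<lambda>\<omega>. J (X \<omega>))) R"
        by (rule emeasure_bind[symmetric, OF MA_ne JX R_m])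
      finally show "emeasure (distr MA (N \<Otimes>\<^sub>M L) (\<lambda>\<omega>. (X \<omega>, Y \<omega>))) R
          = emeasure (MA \<bind> (\<lambda>\<omega>. J (X \<omega>))) R" .
    qed
    have "(\<integral>\<omega>\<in>A. \<psi> (X \<omega>) (Y \<omega>) \<partial>M) = (\<integral>\<omega>. \<psi> (X \<omega>) (Y \<omega>) \<partial>MA)"
      unfolding MA_def set_lebesgue_integral_def
      by (subst integral_density[where g = "indicator A", symmetric]) (auto simp: ennreal_indicator)
    also have "\<dots> = (\<integral>z. case_prod \<psi> z \<partial>distr MA (N \<Otimes>\<^sub>M L) (\<lambda>\<omega>. (X \<omega>, Y \<omega>)))"
      by (subst integral_distr) auto
    also have "\<dots> = (\<integral>\<omega>. (\<integral>z. case_prod \<psi> z \<partial>J (X \<omega>)) \<partial>MA)"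
      unfolding eq
    proof (rule integral_bind[where B = c and B' = 1 and K = "N \<Otimes>\<^sub>M L"])
      show "AE \<omega> in MA. emeasure (J (X \<omega>)) (space (J (X \<omega>))) \<le> ennreal 1"
        using Xs subprob_space_kernel[OF J] by (intro AE_I2) (auto simp: subprob_space.emeasure_space_le_1)
    qed (auto simp: bound space_pair_measure case_prod_beta' MA.finite_measure_axioms)
    also have "\<dots> = (\<integral>\<omega>. (\<integral>y. \<psi> (X \<omega>) y \<partial>T (X \<omega>)) \<partial>MA)"
      using Xs by (intro Bochner_Integration.integral_cong refl) (simp add: \<psi>_J)
    also have "\<dots> = (\<integral>\<omega>\<in>A. (\<integral>y. \<psi> (X \<omega>) y \<partial>T (X \<omega>)) \<partial>M)"
      unfolding MA_def set_lebesgue_integral_def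
      using measurable_from_subalg[OF sub meas]
      by (subst integral_density[where g = "indicator A", symmetric]) (auto simp: ennreal_indicator)
    finally show "(\<integral>\<omega>\<in>A. \<psi> (X \<omega>) (Y \<omega>) \<partial>M) = (\<integral>\<omega>\<in>A. (\<integral>y. \<psi> (X \<omega>) y \<partial>T (X \<omega>)) \<partial>M)" .
  qed
qed

definition kernel_op :: "('a \<Rightarrow> 'a measure) \<Rightarrow> ('a \<Rightarrow> real) \<Rightarrow> 'a \<Rightarrow> real" where
  "kernel_op K g x = (\<integral>y. g y \<partial>K x)"

lemma
  fixes g :: "'a \<Rightarrow> real"
  assumes K: "K \<in> N \<rightarrow>\<^sub>M prob_algebra N" and x: "x \<in> space N"
  shows prob_space_kernel: "prob_space (K x)"
    and sets_prob_kernel: "sets (K x) = sets N"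
    and space_prob_kernel: "space (K x) = space N"
  using measurable_space[OF K x] by (auto simp: space_prob_algebra dest: sets_eq_imp_space_eq)

lemma kernel_op_measurable:
  assumes K: "K \<in> N \<rightarrow>\<^sub>M prob_algebra N" and g: "g \<in> borel_measurable N"
  shows "kernel_op K g \<in> borel_measurable N"
  unfolding kernel_op_def
  using measurable_compose[OF measurable_prob_algebraD[OF K] integral_measurable_subprob_algebra[OF g]] .

lemma kernel_integrable_bounded:
  assumes K: "K \<in> N \<rightarrow>\<^sub>M prob_algebra N" and g: "g \<in> borel_measurable N"
    and x: "x \<in> space N" and bound: "\<And>y. y \<in> space N \<Longrightarrow> \<bar>g y :: real\<bar> \<le> c"
  shows "integrable (K x) g"
proof -
  interpret prob_space "K x" by (rule prob_space_kernel[OF K x])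
  show ?thesis
    using bound g sets_prob_kernel[OF K x] space_prob_kernel[OF K x]
    by (intro integrable_const_bound[of _ c]) (auto cong: measurable_cong_sets)
qed

text \<open>
  Splitting \<open>K x = \<eta> + (K x - \<eta>)\<close>, only the second part, of mass \<open>1 - \<eta>(N)\<close>, depends on \<open>x\<close>.
\<close>

lemma kernel_op_oscillation:
  assumes K: "K \<in> N \<rightarrow>\<^sub>M prob_algebra N"
    and \<eta>: "sets \<eta> = sets N"
    and minor: "\<And>x C. x \<in> space N \<Longrightarrow> C \<in> sets N \<Longrightarrow> emeasure \<eta> C \<le> emeasure (K x) C"
    and g: "g \<in> borel_measurable N"
    and bounds: "\<And>x. x \<in> space N \<Longrightarrow> a \<le> g x \<and> g x \<le> b"
  shows "\<exists>a' b'. b' - a' = (1 - measure \<eta> (space N)) * (b - a) \<and>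
    (\<forall>x\<in>space N. a' \<le> kernel_op K g x \<and> kernel_op K g x \<le> b')"
proof (cases "space N = {}")
  case True
  then show ?thesis
    by (intro exI[of _ 0] exI[of _ "(1 - measure \<eta> (space N)) * (b - a)"]) auto
next
  case False
  then obtain x0 where x0: "x0 \<in> space N" by auto
  have sp: "space \<eta> = space N" using \<eta> by (rule sets_eq_imp_space_eq)
  interpret \<eta>: finite_measure \<eta>
  proof (rule finite_measureI)
    interpret prob_space "K x0" by (rule prob_space_kernel[OF K x0])
    have "emeasure \<eta> (space \<eta>) \<le> 1"
      using minor[OF x0, of "space N"] emeasure_le_1 by (auto simp: sp intro: order_trans)
    then show "emeasure \<eta> (space \<eta>) \<noteq> \<infinity>" by (auto simp: top_unique)
  qed
  have g\<eta>[measurable]: "g \<in> borel_measurable \<eta>" using g \<eta> by (simp cong: measurable_cong_sets)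
  have gb: "\<bar>g y\<bar> \<le> \<bar>a\<bar> + \<bar>b\<bar>" if "y \<in> space N" for y
    using bounds[OF that] by linarith
  have i\<eta>: "integrable \<eta> g"
    by (intro \<eta>.integrable_const_bound[of _ "\<bar>a\<bar> + \<bar>b\<bar>"]) (auto simp: gb sp)
  \<comment> \<open>Domination of measures compares integrals of nonnegative functions only; hence
    the use with g - a and b - g rather than with g.\<close>
  have less: "(\<integral>y. h y \<partial>\<eta>) \<le> (\<integral>y. h y \<partial>K x)"
    if x: "x \<in> space N" and h: "h \<in> borel_measurable N"
      "\<And>y. y \<in> space N \<Longrightarrow> 0 \<le> h y" "\<And>y. y \<in> space N \<Longrightarrow> h y \<le> c" for x c and h :: "_ \<Rightarrow> real"
  proof -
    have iK: "integrable (K x) h"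
      using h by (intro kernel_integrable_bounded[OF K _ x, of _ c]) auto
    have h\<eta>: "h \<in> borel_measurable \<eta>" using h(1) \<eta> by (simp cong: measurable_cong_sets)
    have ih: "integrable \<eta> h"
      using h h\<eta> by (intro \<eta>.integrable_const_bound[of _ c]) (auto simp: sp)
    have "\<eta> \<le> K x"
      using minor[OF x] \<eta> sets_prob_kernel[OF K x] emeasure_notin_sets[of _ \<eta>]
      by (subst le_measure) (auto simp: le_fun_def)
    then have "(\<integral>\<^sup>+y. ennreal (h y) \<partial>\<eta>) \<le> (\<integral>\<^sup>+y. ennreal (h y) \<partial>K x)"
      using \<eta> sets_prob_kernel[OF K x] by (intro nn_integral_mono_measure) auto
    moreover have "(\<integral>\<^sup>+y. ennreal (h y) \<partial>\<eta>) = ennreal (\<integral>y. h y \<partial>\<eta>)"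
      using ih h(2) by (intro nn_integral_eq_integral) (auto simp: sp)
    moreover have "(\<integral>\<^sup>+y. ennreal (h y) \<partial>K x) = ennreal (\<integral>y. h y \<partial>K x)"
      using iK h(2) space_prob_kernel[OF K x] by (intro nn_integral_eq_integral) auto
    moreover have "0 \<le> (\<integral>y. h y \<partial>K x)"
      using h(2) space_prob_kernel[OF K x] by (intro integral_nonneg_AE) auto
    ultimately show ?thesis by simp
  qed
  let ?c = "measure \<eta> (space N)"
  \<comment> \<open>Since g - a >= 0, its integral against \<open>K x\<close> is at least its
    integral against \<eta>; this gives the lower bound, and b - g gives the upper one. In b' - a'
    the integrals of g cancel.\<close>
  define a' where "a' = a + (\<integral>y. g y - a \<partial>\<eta>)"
  define b' where "b' = b - (\<integral>y. b - g y \<partial>\<eta>)"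
  have "b' - a' = (1 - ?c) * (b - a)"
    using i\<eta> by (simp add: a'_def b'_def sp algebra_simps)
  moreover have "a' \<le> kernel_op K g x \<and> kernel_op K g x \<le> b'" if x: "x \<in> space N" for x
  proof -
    interpret Kx: prob_space "K x" by (rule prob_space_kernel[OF K x])
    have iK: "integrable (K x) g"
      using gb by (rule kernel_integrable_bounded[OF K g x])
    have "(\<integral>y. g y - a \<partial>\<eta>) \<le> (\<integral>y. g y - a \<partial>K x)"
      using bounds g by (intro less[OF x, of _ "b - a"]) auto
    moreover have "(\<integral>y. b - g y \<partial>\<eta>) \<le> (\<integral>y. b - g y \<partial>K x)"
      using bounds g by (intro less[OF x, of _ "b - a"]) auto
    ultimately show ?thesis
      using iK by (simp add: a'_def b'_def kernel_op_def Kx.prob_space)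
  qed
  ultimately show ?thesis by blast
qed

lemma kernel_op_abs_le:
  assumes K: "K \<in> N \<rightarrow>\<^sub>M prob_algebra N" and g: "g \<in> borel_measurable N"
    and bound: "\<And>y. y \<in> space N \<Longrightarrow> \<bar>g y\<bar> \<le> c" and x: "x \<in> space N"
  shows "\<bar>kernel_op K g x\<bar> \<le> c"
proof -
  interpret Kx: prob_space "K x" by (rule prob_space_kernel[OF K x])
  have iK: "integrable (K x) g"
    using bound by (rule kernel_integrable_bounded[OF K g x])
  have "\<bar>kernel_op K g x\<bar> \<le> (\<integral>y. \<bar>g y\<bar> \<partial>K x)"
    unfolding kernel_op_def by (rule integral_abs_bound)
  also have "\<dots> \<le> (\<integral>y. c \<partial>K x)"
    using bound iK space_prob_kernel[OF K x] by (intro integral_mono) auto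
  finally show ?thesis by (simp add: Kx.prob_space)
qed

text \<open>Invariance on sets says that the mixture of the \<open>K x\<close> under \<nu> is \<nu>
  itself; integrating g against this equality of measures extends it to functions.\<close>

lemma kernel_op_invariant:
  assumes K: "K \<in> N \<rightarrow>\<^sub>M prob_algebra N" and g: "g \<in> borel_measurable N"
    and bound: "\<And>y. y \<in> space N \<Longrightarrow> \<bar>g y\<bar> \<le> c"
    and \<nu>: "prob_space \<nu>" "sets \<nu> = sets N"
    and inv: "\<And>C. C \<in> sets N \<Longrightarrow> (\<integral>\<^sup>+x. emeasure (K x) C \<partial>\<nu>) = emeasure \<nu> C"
  shows "(\<integral>x. kernel_op K g x \<partial>\<nu>) = (\<integral>x. g x \<partial>\<nu>)"
proof -
  interpret \<nu>: prob_space \<nu> by fact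
  have sp: "space \<nu> = space N" using \<nu>(2) by (rule sets_eq_imp_space_eq)
  have K\<nu>: "K \<in> \<nu> \<rightarrow>\<^sub>M subprob_algebra N"
    using measurable_prob_algebraD[OF K] \<nu>(2) by (simp cong: measurable_cong_sets)
  have "\<nu> \<bind> K = \<nu>"
  proof (rule measure_eqI)
    show "sets (\<nu> \<bind> K) = sets \<nu>"
      using sets_bind[OF sets_kernel[OF K\<nu>]] \<nu>(2) \<nu>.not_empty by simp
    then show "emeasure (\<nu> \<bind> K) C = emeasure \<nu> C" if "C \<in> sets (\<nu> \<bind> K)" for C
      using that \<nu>(2) inv emeasure_bind[OF \<nu>.not_empty K\<nu>] by simp
  qed
  moreover have "(\<integral>x. g x \<partial>(\<nu> \<bind> K)) = (\<integral>x. (\<integral>y. g y \<partial>K x) \<partial>\<nu>)"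
    by (rule integral_bind[OF g bound K\<nu>, where B' = 1])
      (auto intro!: AE_I2 prob_space.emeasure_le_1 prob_space_kernel[OF K] simp: \<nu>.finite_measure_axioms sp)
  ultimately show ?thesis by (simp add: kernel_op_def)
qed

text \<open>The average of K^j g along the chain differs from that of K^(j+1) g by a martingale
  average and a boundary term of size 2c / n, so all iterates share the limiting behaviour of g. For
  large j the iterate is uniformly close to the constant
  \<open>\<integral>x. g x \<partial>\<nu>\<close>, and so is its average along every path.\<close>

lemma (in prob_space) doeblin_law_of_large_numbers:
  fixes Z :: "nat \<Rightarrow> 'a \<Rightarrow> 'b" and g :: "'b \<Rightarrow> real"
  assumes sub: "\<And>i. subalgebra M (F i)"
    and mono: "\<And>i j. i \<le> j \<Longrightarrow> sets (F i) \<subseteq> sets (F j)"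
    and Z: "\<And>i. Z i \<in> F i \<rightarrow>\<^sub>M N"
    and K: "K \<in> N \<rightarrow>\<^sub>M prob_algebra N"
    and markov: "\<And>i C. C \<in> sets N \<Longrightarrow>
      AE \<omega> in M. real_cond_exp M (F i) (\<lambda>\<omega>. indicator C (Z (Suc i) \<omega>)) \<omega> = measure (K (Z i \<omega>)) C"
    and \<eta>: "sets \<eta> = sets N" "emeasure \<eta> (space \<eta>) \<noteq> 0"
    and minor: "\<And>x C. x \<in> space N \<Longrightarrow> C \<in> sets N \<Longrightarrow> emeasure \<eta> C \<le> emeasure (K x) C"
    and \<nu>: "prob_space \<nu>" "sets \<nu> = sets N"
    and inv: "\<And>C. C \<in> sets N \<Longrightarrow> (\<integral>\<^sup>+x. emeasure (K x) C \<partial>\<nu>) = emeasure \<nu> C"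
    and g: "g \<in> borel_measurable N"
    and bound: "\<And>y. y \<in> space N \<Longrightarrow> \<bar>g y\<bar> \<le> c"
  shows "AE \<omega> in M. (\<lambda>n. (\<Sum>i<n. g (Z i \<omega>)) / real n) \<longlonglongrightarrow> (\<integral>x. g x \<partial>\<nu>)"
proof -
  interpret \<nu>: prob_space \<nu> by fact
  have sp\<nu>: "space \<nu> = space N" using \<nu>(2) by (rule sets_eq_imp_space_eq)
  have sp\<eta>: "space \<eta> = space N" using \<eta>(1) by (rule sets_eq_imp_space_eq)
  have ZM[measurable]: "Z i \<in> M \<rightarrow>\<^sub>M N" for i by (rule measurable_from_subalg[OF sub Z])
  have Zs: "Z i \<omega> \<in> space N" if "\<omega> \<in> space M" for i \<omega>
    using measurable_space[OF ZM that] .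
  obtain x0 where x0: "x0 \<in> space N" using \<nu>.not_empty sp\<nu> by auto
  interpret Kx0: prob_space "K x0" by (rule prob_space_kernel[OF K x0])
  \<comment> \<open>The contraction factor: \<open>r < 1\<close> because \<eta> is not zero, and
    \<open>0 \<le> r\<close> because \<eta> lies below a probability measure.\<close>
  define r where "r = 1 - measure \<eta> (space N)"
  have \<eta>1: "emeasure \<eta> (space N) \<le> 1"
    using minor[OF x0, of "space N"] Kx0.emeasure_le_1 by (auto intro: order_trans)
  then have "emeasure \<eta> (space N) = ennreal (measure \<eta> (space N))"
    by (intro emeasure_eq_ennreal_measure) (auto simp: top_unique)
  with \<eta>1 \<eta>(2) have r: "0 \<le> r" "r < 1"
    by (auto simp: r_def sp\<eta> measure_nonneg less_le ennreal_eq_0_iff)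
  define h where "h j = (kernel_op K ^^ j) g" for j
  have h_Suc: "h (Suc j) = kernel_op K (h j)" for j by (simp add: h_def)
  have h_meas: "h j \<in> borel_measurable N" for j
    by (induction j) (auto simp: h_Suc kernel_op_measurable[OF K], simp add: h_def g)
  have h_bound: "\<bar>h j x\<bar> \<le> c" if "x \<in> space N" for j x
    using that
    by (induction j arbitrary: x) (auto simp: h_Suc intro!: kernel_op_abs_le[OF K h_meas], simp add: h_def bound)
  have h_int: "(\<integral>x. h j x \<partial>\<nu>) = (\<integral>x. g x \<partial>\<nu>)" for j
    by (induction j) (simp add: h_def, metis h_Suc kernel_op_invariant[OF K h_meas h_bound \<nu> inv])
  have h_osc: "\<exists>a b. b - a = r ^ j * (2 * c) \<and> (\<forall>x\<in>space N. a \<le> h j x \<and> h j x \<le> b)" for j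
  proof (induction j)
    case 0
    show ?case
      by (intro exI[of _ "- c"] exI[of _ c]) (use bound in \<open>auto simp: h_def abs_le_iff minus_le_iff\<close>)
  next
    case (Suc j)
    then obtain a b where ab: "b - a = r ^ j * (2 * c)" "\<And>x. x \<in> space N \<Longrightarrow> a \<le> h j x \<and> h j x \<le> b"
      by blast
    from kernel_op_oscillation[OF K \<eta>(1) minor h_meas[of j] ab(2)]
    obtain a' b' where "b' - a' = (1 - measure \<eta> (space N)) * (b - a)"
      "\<forall>x\<in>space N. a' \<le> kernel_op K (h j) x \<and> kernel_op K (h j) x \<le> b'" by blast
    then show ?case using ab(1) by (intro exI[of _ a'] exI[of _ b']) (simp add: h_Suc r_def)
  qed
  \<comment> \<open>By invariance the \<nu>-mean of \<open>h j\<close> is that of g, and it lies in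
    the same short interval as all values of \<open>h j\<close>.\<close>
  have h_near: "\<bar>h j x - (\<integral>x. g x \<partial>\<nu>)\<bar> \<le> r ^ j * (2 * c)" if x: "x \<in> space N" for j x
  proof -
    obtain a b where ab: "b - a = r ^ j * (2 * c)" "\<And>x. x \<in> space N \<Longrightarrow> a \<le> h j x \<and> h j x \<le> b"
      using h_osc[of j] by blast
    have i: "integrable \<nu> (h j)"
      using h_meas[of j] h_bound \<nu>(2)
      by (intro \<nu>.integrable_const_bound[of _ c]) (auto simp: sp\<nu> cong: measurable_cong_sets)
    have "a \<le> (\<integral>x. h j x \<partial>\<nu>)" "(\<integral>x. h j x \<partial>\<nu>) \<le> b"
      using ab(2) by (auto intro!: \<nu>.integral_ge_const \<nu>.integral_le_const i simp: sp\<nu>)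
    with ab x show ?thesis unfolding h_int by (auto simp: abs_le_iff) fastforce+
  qed
  have step: "AE \<omega> in M. (\<lambda>n. (\<Sum>i<n. h j (Z (Suc i) \<omega>) - h (Suc j) (Z i \<omega>)) / real n) \<longlonglongrightarrow> 0" for j
  proof -
    have "AE \<omega> in M. \<forall>i. real_cond_exp M (F i) (\<lambda>\<omega>. h j (Z (Suc i) \<omega>)) \<omega> = h (Suc j) (Z i \<omega>)"
      unfolding AE_all_countable
    proof
      fix i
      have "AE \<omega> in M. real_cond_exp M (F i) (\<lambda>\<omega>. h j (Z (Suc i) \<omega>)) \<omega> = (\<integral>y. h j y \<partial>K (Z i \<omega>))"
        by (rule real_cond_exp_eq_kernel_integral[OF sub Z _ K, where G = "sets N" and \<psi> = "\<lambda>x. h j"])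
          (use h_bound h_meas in \<open>auto intro!: markov simp: Int_stable_def sets.space_closed sets.sigma_sets_eq\<close>)
      then show "AE \<omega> in M. real_cond_exp M (F i) (\<lambda>\<omega>. h j (Z (Suc i) \<omega>)) \<omega> = h (Suc j) (Z i \<omega>)"
        by (simp add: h_Suc kernel_op_def)
    qed
    moreover have "AE \<omega> in M. (\<lambda>n. (\<Sum>i<n. h j (Z (Suc i) \<omega>)
        - real_cond_exp M (F i) (\<lambda>\<omega>. h j (Z (Suc i) \<omega>)) \<omega>) / real n) \<longlonglongrightarrow> 0"
      by (rule slln_bounded_martingale_differences[OF sub mono, where c = c])
        (auto intro!: measurable_compose[OF Z h_meas] h_bound Zs)
    ultimately show ?thesis by eventually_elim simp
  qed
  then have "AE \<omega> in M. \<forall>j. (\<lambda>n. (\<Sum>i<n. h j (Z (Suc i) \<omega>) - h (Suc j) (Z i \<omega>)) / real n) \<longlonglongrightarrow> 0"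
    by (simp add: AE_all_countable)
  then show ?thesis
    using AE_space[of M]
  proof eventually_elim
    case (elim \<omega>)
    define avg where "avg j n = (\<Sum>i<n. h j (Z i \<omega>)) / real n" for j n
    have b: "\<bar>h j (Z i \<omega>)\<bar> \<le> c" for i j using h_bound Zs elim by auto
    have shift: "(\<lambda>n. avg j n - avg (Suc j) n) \<longlonglongrightarrow> 0" for j
    proof -
      \<comment> \<open>The martingale compares \<open>h j\<close> at time i + 1 with
        \<open>h (Suc j)\<close> at time i; realigning the indices leaves only the first and last
        terms.\<close>
      have eq: "avg j n - avg (Suc j) n
          = (\<Sum>i<n. h j (Z (Suc i) \<omega>) - h (Suc j) (Z i \<omega>)) / real n
            + (h j (Z 0 \<omega>) - h j (Z n \<omega>)) / real n" for n
      proof -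
        have "(\<Sum>i<n. h j (Z (Suc i) \<omega>)) = (\<Sum>i<n. h j (Z i \<omega>)) + h j (Z n \<omega>) - h j (Z 0 \<omega>)"
          by (induction n) auto
        then show ?thesis
          by (simp add: avg_def sum_subtractf add_divide_distrib diff_divide_distrib)
      qed
      have "(\<lambda>n. (h j (Z 0 \<omega>) - h j (Z n \<omega>)) / real n) \<longlonglongrightarrow> 0"
      proof (rule Lim_null_comparison)
        show "(\<lambda>n. (2 * c) * inverse (real n)) \<longlonglongrightarrow> 0"
          using tendsto_mult[OF tendsto_const lim_inverse_n, of "2 * c"] by simp
        show "\<forall>\<^sub>F n in sequentially. norm ((h j (Z 0 \<omega>) - h j (Z n \<omega>)) / real n) \<le> 2 * c * inverse (real n)"
        proof (intro always_eventually allI)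
          fix n
          have "\<bar>h j (Z 0 \<omega>) - h j (Z n \<omega>)\<bar> \<le> 2 * c" using b[of j 0] b[of j n] by linarith
          then have "\<bar>h j (Z 0 \<omega>) - h j (Z n \<omega>)\<bar> / real n \<le> 2 * c / real n"
            by (intro divide_right_mono) auto
          then show "norm ((h j (Z 0 \<omega>) - h j (Z n \<omega>)) / real n) \<le> 2 * c * inverse (real n)"
            by (simp add: abs_mult divide_inverse)
        qed
      qed
      then show ?thesis
        unfolding eq using elim(1) by (intro tendsto_add_zero) auto
    qed
    have diff: "(\<lambda>n. avg 0 n - avg j n) \<longlonglongrightarrow> 0" for j
    proof (induction j)
      case (Suc j)
      from tendsto_add[OF this shift[of j]] show ?case by simp
    qed simp
    have "avg 0 \<longlonglongrightarrow> (\<integral>x. g x \<partial>\<nu>)"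
    proof (rule LIMSEQ_I)
      fix e :: real assume e: "0 < e"
      \<comment> \<open>The index j is fixed before n: \<open>diff\<close> gives convergence for
        each j but no uniformity in j.\<close>
      have "(\<lambda>j. r ^ j * (2 * c)) \<longlonglongrightarrow> 0 * (2 * c)"
        using r by (intro tendsto_mult LIMSEQ_power_zero tendsto_const) auto
      then have "\<forall>\<^sub>F j in sequentially. r ^ j * (2 * c) < e / 2"
        using e by (intro order_tendstoD(2)) auto
      then obtain j where j: "r ^ j * (2 * c) < e / 2"
        by (auto simp: eventually_sequentially)
      have "\<forall>\<^sub>F n in sequentially. \<bar>avg 0 n - avg j n\<bar> < e / 2"
        using tendstoD[OF diff[of j], of "e / 2"] e by simp
      then have "\<forall>\<^sub>F n in sequentially. norm (avg 0 n - (\<integral>x. g x \<partial>\<nu>)) < e"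
        using eventually_gt_at_top[of 0]
      proof eventually_elim
        case (elim n)
        have "avg j n - (\<integral>x. g x \<partial>\<nu>) = (\<Sum>i<n. h j (Z i \<omega>) - (\<integral>x. g x \<partial>\<nu>)) / real n"
          using elim(2) by (simp add: avg_def sum_subtractf field_simps)
        also have "\<bar>\<dots>\<bar> \<le> (\<Sum>i<n. r ^ j * (2 * c)) / real n"
          unfolding abs_divide using h_near Zs \<open>\<omega> \<in> space M\<close>
          by (simp del: sum_constant) (intro divide_right_mono order_trans[OF sum_abs] sum_mono, auto)
        also have "\<dots> = r ^ j * (2 * c)" using elim(2) by simp
        finally have "\<bar>avg j n - (\<integral>x. g x \<partial>\<nu>)\<bar> \<le> r ^ j * (2 * c)" .
        with elim(1) j show ?case unfolding real_norm_def by linarith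
      qed
      then show "\<exists>no. \<forall>n\<ge>no. norm (avg 0 n - (\<integral>x. g x \<partial>\<nu>)) < e"
        by (simp add: eventually_sequentially)
    qed
    then show ?case by (simp add: avg_def[abs_def] h_def)
  qed
qed

section \<open>Uniform convergence of decreasing functions\<close>

text \<open>A Polya type argument: between two neighbouring grid points, monotonicity traps
  \<open>g n s\<close> between values already close to h, and h varies little on the cell.
  Convergence is requested only at rational fractions of the interval, a countable set, so that it
  can be had almost surely at all of them together.\<close>

lemma SUP_abs_diff_tendsto_0_of_antimono:
  fixes g :: "nat \<Rightarrow> real \<Rightarrow> real" and h :: "real \<Rightarrow> real"
  assumes ab: "a < b"
    and anti: "\<And>n x y. a \<le> x \<Longrightarrow> x \<le> y \<Longrightarrow> y \<le> b \<Longrightarrow> g n y \<le> g n x"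
    and cont: "continuous_on {a..b} h"
    and conv: "\<And>i N. i \<le> N \<Longrightarrow> 0 < N \<Longrightarrow>
      (\<lambda>n. g n (a + (b - a) * (real i / real N))) \<longlonglongrightarrow> h (a + (b - a) * (real i / real N))"
  shows "(\<lambda>n. SUP s\<in>{a..b}. \<bar>g n s - h s\<bar>) \<longlonglongrightarrow> 0"
proof (rule LIMSEQ_I)
  fix e :: real assume e: "0 < e"
  \<comment> \<open>One \<epsilon> is spent on convergence at a grid point and one on the variation
    of h; the resulting bound e / 2 is strictly below e.\<close>
  define \<epsilon> where "\<epsilon> = e / 4"
  have \<epsilon>: "0 < \<epsilon>" using e by (simp add: \<epsilon>_def)
  have "uniformly_continuous_on {a..b} h"
    using cont by (intro compact_uniformly_continuous) auto
  then obtain \<delta> where \<delta>: "0 < \<delta>"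
    "\<And>x y. x \<in> {a..b} \<Longrightarrow> y \<in> {a..b} \<Longrightarrow> dist x y < \<delta> \<Longrightarrow> dist (h x) (h y) < \<epsilon>"
    using \<epsilon> unfolding uniformly_continuous_on_def by metis
  obtain N :: nat where N: "(b - a) / \<delta> < real N" using reals_Archimedean2 by blast
  have N0: "0 < N" using N ab \<delta>(1) by (metis divide_pos_pos diff_gt_0_iff_gt of_nat_0_less_iff order.strict_trans)
  have mesh: "(b - a) / real N < \<delta>" using N N0 \<delta>(1) by (simp add: field_simps)
  define p where "p i = a + (b - a) * (real i / real N)" for i :: nat
  have p_in: "p i \<in> {a..b}" if "i \<le> N" for i
  proof -
    have "(b - a) * (real i / real N) \<le> (b - a) * 1"
      using that N0 ab by (intro mult_left_mono) auto
    then show ?thesis using ab by (simp add: p_def)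
  qed
  have "\<forall>\<^sub>F n in sequentially. \<forall>i\<in>{..N}. \<bar>g n (p i) - h (p i)\<bar> < \<epsilon>"
  proof (intro eventually_ball_finite ballI)
    fix i assume "i \<in> {..N}"
    then show "\<forall>\<^sub>F n in sequentially. \<bar>g n (p i) - h (p i)\<bar> < \<epsilon>"
      using tendstoD[OF conv[of i N] \<epsilon>] N0 by (simp add: p_def dist_real_def)
  qed simp
  then have "\<forall>\<^sub>F n in sequentially. norm ((SUP s\<in>{a..b}. \<bar>g n s - h s\<bar>) - 0) < e"
  proof eventually_elim
    case (elim n)
    have near: "\<bar>g n s - h s\<bar> \<le> 2 * \<epsilon>" if s: "s \<in> {a..b}" for s
    proof -
      \<comment> \<open>The position of s in units of the mesh; i and j index the grid points on
        either side. The minimum in j keeps the right neighbour inside the grid when s = b.\<close>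
      define u where "u = (s - a) / (b - a) * real N"
      define i where "i = nat \<lfloor>u\<rfloor>"
      define j where "j = min (Suc i) N"
      have u: "0 \<le> u" "u \<le> real N" "s = a + (b - a) * (u / real N)"
        using s ab N0 by (auto simp: u_def field_simps mult_left_mono)
      have i: "real i \<le> u" "u < real i + 1" using u(1) by (auto simp: i_def)
      have iN: "i \<le> N" using i u by linarith
      have j: "u \<le> real j" "real j \<le> real i + 1" "real i \<le> real j" "j \<le> N"
        using i u iN by (auto simp: j_def min_def)
      have ps: "p i \<le> s" "s \<le> p j"
        unfolding p_def u(3) using ab N0 i j by (auto intro!: mult_left_mono divide_right_mono)
      have "p j - p i = (b - a) * ((real j - real i) / real N)"
        by (simp add: p_def algebra_simps diff_divide_distrib)
      also have "\<dots> \<le> (b - a) * (1 / real N)"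
        using ab j N0 by (intro mult_left_mono divide_right_mono) auto
      finally have "p j - p i < \<delta>" using mesh by simp
      then have "dist (p i) s < \<delta>" "dist (p j) s < \<delta>"
        using ps unfolding dist_real_def by linarith+
      then have "dist (h (p i)) (h s) < \<epsilon>" "dist (h (p j)) (h s) < \<epsilon>"
        using \<delta>(2) s p_in iN j(4) by blast+
      moreover have "g n s \<le> g n (p i)" "g n (p j) \<le> g n s"
        using ps s p_in[OF iN] p_in[OF j(4)] by (auto intro!: anti)
      moreover have "\<bar>g n (p i) - h (p i)\<bar> < \<epsilon>" "\<bar>g n (p j) - h (p j)\<bar> < \<epsilon>"
        using elim iN j(4) by auto
      ultimately show ?thesis unfolding dist_real_def by linarith
    qed
    have ne: "{a..b} \<noteq> {}" using ab by auto
    have "(SUP s\<in>{a..b}. \<bar>g n s - h s\<bar>) \<le> 2 * \<epsilon>"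
      using near ne by (intro cSUP_least) auto
    \<comment> \<open>A value is below a real supremum only when the set is bounded above;
      \<open>near\<close> supplies that bound.\<close>
    moreover have "0 \<le> (SUP s\<in>{a..b}. \<bar>g n s - h s\<bar>)"
      using near ab by (intro cSUP_upper2[of _ _ a] bdd_aboveI2[of _ _ "2 * \<epsilon>"]) auto
    ultimately show ?case using e by (simp add: \<epsilon>_def)
  qed
  then show "\<exists>no. \<forall>n\<ge>no. norm ((SUP s\<in>{a..b}. \<bar>g n s - h s\<bar>) - 0) < e"
    by (simp add: eventually_sequentially)
qed

section \<open>Interarrival law and transition kernel\<close>

context regular_pdmp
begin

abbreviation state_space :: "'a measure" where
  "state_space \<equiv> restrict_space borel E"

lemma space_state_space[simp]: "space state_space = E"
  by (simp add: space_restrict_space)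

lemma E_borel[measurable]: "E \<in> sets borel"
  using open_E by simp

lemma sets_state_space_iff: "C \<in> sets state_space \<longleftrightarrow> C \<in> sets borel \<and> C \<subseteq> E"
  by (subst sets_restrict_space_iff) (auto)

lemma flow_in_closure: "\<xi> \<in> E \<Longrightarrow> 0 \<le> t \<Longrightarrow> \<Phi> \<xi> t \<in> closure E"
  using measurable_space[OF flow_measurable, of "(\<xi>, t)"]
  by (auto simp: space_pair_measure space_restrict_space)

text \<open>
  Functions of time are frozen at negative times by \<open>max 0\<close>, so that measurability can be stated on
  the whole real line although the data are only constrained at nonnegative times.
\<close>

lemma flow_max_measurable:
  "(\<lambda>z. \<Phi> (fst z) (max 0 (snd z))) \<in> state_space \<Otimes>\<^sub>M borel \<rightarrow>\<^sub>M restrict_space borel (closure E)"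
proof -
  have "(\<lambda>z. (fst z, max 0 (snd z))) \<in> state_space \<Otimes>\<^sub>M borel \<rightarrow>\<^sub>M
      state_space \<Otimes>\<^sub>M restrict_space borel {0::real..}"
    by (intro measurable_Pair measurable_fst measurable_restrict_space2[of "\<lambda>z. max 0 (snd z)"]) auto
  from measurable_compose[OF this flow_measurable] show ?thesis
    by (simp add: case_prod_beta')
qed

lemma rate_flow_measurable[measurable]:
  "(\<lambda>z. rate (\<Phi> (fst z) (max 0 (snd z)))) \<in> borel_measurable (state_space \<Otimes>\<^sub>M borel)"
  using measurable_compose[OF flow_max_measurable rate_measurable] .

lemma rate_path_measurable:
  "\<xi> \<in> E \<Longrightarrow> (\<lambda>s. rate (\<Phi> \<xi> (max 0 s))) \<in> borel_measurable borel"
  using measurable_compose[OF measurable_Pair1' rate_flow_measurable, of \<xi>] by simp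

text \<open>The dominating function controls the rate up to any finite horizon, where local
  integrability alone speaks of a neighbourhood of time 0.\<close>

lemma set_integrable_rate:
  assumes "\<xi> \<in> E"
  shows "set_integrable lborel {0..T} (\<lambda>s. rate (\<Phi> \<xi> s))"
proof (cases "0 \<le> T")
  case True
  obtain B where B: "\<And>t. 0 \<le> t \<Longrightarrow> 0 \<le> B t" "\<And>T. 0 \<le> T \<Longrightarrow> set_integrable lborel {0..T} B"
    "\<And>\<xi> t. \<xi> \<in> E \<Longrightarrow> 0 \<le> t \<Longrightarrow> rate (\<Phi> \<xi> t) \<le> B t"
    using rate_dominated by metis
  have "set_integrable lborel {0..T} (\<lambda>s. rate (\<Phi> \<xi> (max 0 s)))"
  proof (rule set_integrable_bound[OF B(2)[OF True]])
    show "set_borel_measurable lborel {0..T} (\<lambda>s. rate (\<Phi> \<xi> (max 0 s)))"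
      using rate_path_measurable[OF assms] by (simp add: set_borel_measurable_def)
    show "AE s in lborel. s \<in> {0..T} \<longrightarrow> norm (rate (\<Phi> \<xi> (max 0 s))) \<le> norm (B s)"
    proof (intro AE_I2 impI)
      fix s assume s: "s \<in> {0..T}"
      then have "0 \<le> rate (\<Phi> \<xi> s)" using flow_in_closure[OF assms] rate_nonneg by auto
      then show "norm (rate (\<Phi> \<xi> (max 0 s))) \<le> norm (B s)"
        using s B(1)[of s] B(3)[OF assms, of s] by (auto simp: max_def)
    qed
  qed
  moreover have "set_integrable lborel {0..T} (\<lambda>s. rate (\<Phi> \<xi> (max 0 s)))
      \<longleftrightarrow> set_integrable lborel {0..T} (\<lambda>s. rate (\<Phi> \<xi> s))"
    by (rule set_integrable_cong) auto
  ultimately show ?thesis by simp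
qed (simp add: set_integrable_def)

section \<open>The survival function: continuity, derivative and monotonicity\<close>

abbreviation G :: "'a \<Rightarrow> real \<Rightarrow> real" where "G \<equiv> surv \<Phi> rate"

abbreviation f :: "'a \<Rightarrow> real \<Rightarrow> real" where "f \<equiv> dens \<Phi> rate"

abbreviation ts :: "'a \<Rightarrow> real" where "ts \<equiv> tstar E \<Phi>"

text \<open>With the gauge integral in the exponent, the theorems on continuity and differentiation
  of indefinite integrals become available.\<close>

lemma surv_eq_integral:
  "\<xi> \<in> E \<Longrightarrow> G \<xi> t = exp (- integral {0..t} (\<lambda>s. rate (\<Phi> \<xi> s)))"
  unfolding surv_def by (subst set_borel_integral_eq_integral(2)[OF set_integrable_rate]) simp_all

lemma surv_pos: "0 < G \<xi> t"
  by (simp add: surv_def)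

lemma surv_0: "\<xi> \<in> E \<Longrightarrow> G \<xi> 0 = 1"
  by (simp add: surv_eq_integral)

lemma surv_continuous:
  assumes \<xi>: "\<xi> \<in> E" shows "continuous_on {0..} (G \<xi>)"
proof -
  have "continuous_on {0..T} (G \<xi>)" for T
  proof -
    have "continuous_on {0..T} (\<lambda>t. exp (- integral {0..t} (\<lambda>s. rate (\<Phi> \<xi> s))))"
      using set_borel_integral_eq_integral(1)[OF set_integrable_rate[OF \<xi>]]
      by (intro continuous_intros indefinite_integral_continuous_1)
    then show ?thesis using surv_eq_integral[OF \<xi>] by (simp cong: continuous_on_cong)
  qed
  note * = this
  show ?thesis
  proof (rule continuous_on_eq_continuous_within[THEN iffD2], intro ballI)
    fix t :: real assume t: "t \<in> {0..}"
    have "continuous (at t within {0..t + 1}) (G \<xi>)"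
      using *[of "t + 1"] t by (auto simp: continuous_on_eq_continuous_within)
    \<comment> \<open>The two sets agree near t, so continuity on bounded intervals glues to the
      half line.\<close>
    moreover have "at t within {0..t + 1} = at t within {0..}"
      by (rule at_within_nhd[of _ "{..<t + 1}"]) auto
    ultimately show "continuous (at t within {0..}) (G \<xi>)" by simp
  qed
qed

text \<open>Continuity in time is assumed for \<open>f\<close>, not for the rate. Along a trajectory
  the rate is f / G with G continuous and positive, hence continuous, and the fundamental theorem
  applies to the exponent.\<close>

lemma surv_has_derivative:
  assumes \<xi>: "\<xi> \<in> E" and t: "0 \<le> t" "t \<le> T"
  shows "(G \<xi> has_real_derivative - f \<xi> t) (at t within {0..T})"
proof -
  have "continuous_on {0..} (\<lambda>s. f \<xi> s / G \<xi> s)"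
    using surv_pos by (intro continuous_intros dens_continuous surv_continuous \<xi>) (simp add: less_imp_neq[symmetric])
  moreover have "f \<xi> s / G \<xi> s = rate (\<Phi> \<xi> s)" for s
    using surv_pos[of \<xi> s] by (simp add: dens_def)
  ultimately have c: "continuous_on {0..T} (\<lambda>s. rate (\<Phi> \<xi> s))"
    by (auto elim: continuous_on_subset)
  have "((\<lambda>t. exp (- integral {0..t} (\<lambda>s. rate (\<Phi> \<xi> s)))) has_real_derivative
      exp (- integral {0..t} (\<lambda>s. rate (\<Phi> \<xi> s))) * - rate (\<Phi> \<xi> t)) (at t within {0..T})"
    using t by (intro DERIV_chain2[OF DERIV_exp] derivative_intros integral_has_real_derivative c) auto
  then show ?thesis
    by (simp add: surv_eq_integral[OF \<xi>, symmetric] dens_def mult.commute)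
qed

lemma dens_measurable: "\<xi> \<in> E \<Longrightarrow> (\<lambda>s. f \<xi> (max 0 s)) \<in> borel_measurable borel"
  by (intro borel_measurable_continuous_onI continuous_on_compose2[OF dens_continuous] continuous_intros) auto

lemma nn_integral_dens:
  assumes \<xi>: "\<xi> \<in> E" and ab: "0 \<le> a" "a \<le> b"
  shows "(\<integral>\<^sup>+s. ennreal (f \<xi> (max 0 s)) * indicator {a..b} s \<partial>lborel) = ennreal (G \<xi> a - G \<xi> b)"
proof -
  have "((\<lambda>s. f \<xi> (max 0 s)) has_integral - G \<xi> b - - G \<xi> a) {a..b}"
  proof (rule fundamental_theorem_of_calculus[OF ab(2)])
    fix s assume s: "s \<in> {a..b}"
    have "(G \<xi> has_real_derivative - f \<xi> s) (at s within {0..b})"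
      using s ab by (intro surv_has_derivative[OF \<xi>]) auto
    then have "(G \<xi> has_real_derivative - f \<xi> s) (at s within {a..b})"
      using ab by (auto elim: DERIV_subset)
    from DERIV_minus[OF this]
    show "((\<lambda>s. - G \<xi> s) has_vector_derivative f \<xi> (max 0 s)) (at s within {a..b})"
      using s ab by (simp add: has_real_derivative_iff_has_vector_derivative max_def)
  qed
  then have "(\<integral>\<^sup>+s. ennreal (f \<xi> (max 0 s)) * indicator {a..b} s \<partial>lborel) = ennreal (- G \<xi> b - - G \<xi> a)"
    using dens_pos[OF \<xi>, of "max 0 _"]
    by (intro nn_integral_has_integral_lebesgue') (auto intro: less_imp_le)
  then show ?thesis by simp
qed

lemma surv_antimono:
  assumes \<xi>: "\<xi> \<in> E" and st: "0 \<le> s" "s \<le> t"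
  shows "G \<xi> t \<le> G \<xi> s"
proof -
  have c: "continuous_on {s..t} (G \<xi>)"
    using st by (intro continuous_on_subset[OF surv_continuous[OF \<xi>]]) auto
  show ?thesis
  proof (rule DERIV_nonpos_imp_decreasing_open[OF st(2) _ c])
    fix x assume x: "s < x" "x < t"
    have "(G \<xi> has_real_derivative - f \<xi> x) (at x within {0..t})"
      using x st by (intro surv_has_derivative[OF \<xi>]) auto
    moreover have "at x within {0..t} = at x"
      using x st by (intro at_within_interior) auto
    ultimately show "\<exists>y. (G \<xi> has_real_derivative y) (at x) \<and> y \<le> 0"
      using dens_pos[OF \<xi>, of x] x st by (intro exI[of _ "- f \<xi> x"]) auto
  qed
qed

lemma surv_le_1: "\<xi> \<in> E \<Longrightarrow> 0 \<le> t \<Longrightarrow> G \<xi> t \<le> 1"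
  using surv_antimono[of \<xi> 0 t] by (simp add: surv_0)

text \<open>With I the integrated rate, G t = G s exp(-(I t - I s)); the bound follows from exp(-u)
  >= 1 - u and G s <= 1. It trades an increment of G for one of I, which can be dominated uniformly
  in the state.\<close>

lemma surv_diff_le:
  assumes \<xi>: "\<xi> \<in> E" and st: "0 \<le> s" "s \<le> t"
  shows "G \<xi> s - G \<xi> t \<le> integral {0..t} (\<lambda>s. rate (\<Phi> \<xi> s)) - integral {0..s} (\<lambda>s. rate (\<Phi> \<xi> s))"
proof -
  let ?I = "\<lambda>t. integral {0..t} (\<lambda>s. rate (\<Phi> \<xi> s))"
  have "G \<xi> t = G \<xi> s * exp (- (?I t - ?I s))"
    unfolding surv_eq_integral[OF \<xi>] by (simp add: exp_add[symmetric])
  moreover have "1 - (?I t - ?I s) \<le> exp (- (?I t - ?I s))"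
    using exp_ge_add_one_self[of "- (?I t - ?I s)"] by linarith
  ultimately have "G \<xi> s - G \<xi> t \<le> G \<xi> s * (?I t - ?I s)"
    using surv_pos[of \<xi> s] mult_left_mono[of "1 - (?I t - ?I s)" "exp (- (?I t - ?I s))" "G \<xi> s"]
    by (simp add: algebra_simps)
  also have "\<dots> \<le> 1 * (?I t - ?I s)"
  proof (intro mult_right_mono surv_le_1 \<xi> st)
    have "G \<xi> t \<le> G \<xi> s" using surv_antimono[OF \<xi> st] .
    then show "0 \<le> ?I t - ?I s" unfolding surv_eq_integral[OF \<xi>] by simp
  qed
  finally show ?thesis by simp
qed

lemma surv_measurable: "0 \<le> t \<Longrightarrow> (\<lambda>\<xi>. G \<xi> t) \<in> borel_measurable state_space"
proof -
  assume t: "0 \<le> t"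
  have "(\<lambda>\<xi>. \<integral>s. indicator {0..t} s *\<^sub>R rate (\<Phi> \<xi> (max 0 s)) \<partial>lborel) \<in> borel_measurable state_space"
    using rate_flow_measurable
    by (intro lborel.borel_measurable_lebesgue_integral)
      (auto simp: case_prod_beta' intro!: borel_measurable_scaleR borel_measurable_indicator'
        cong: measurable_cong_sets)
  then have "(\<lambda>\<xi>. exp (- (\<integral>s. indicator {0..t} s *\<^sub>R rate (\<Phi> \<xi> (max 0 s)) \<partial>lborel))) \<in> borel_measurable state_space"
    by measurable
  moreover have "(\<integral>s. indicator {0..t} s *\<^sub>R rate (\<Phi> \<xi> (max 0 s)) \<partial>lborel)
     = (LBINT s:{0..t}. rate (\<Phi> \<xi> s))" for \<xi>
    unfolding set_lebesgue_integral_def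
    by (intro Bochner_Integration.integral_cong) (auto simp: max_def split: split_indicator)
  ultimately show ?thesis unfolding surv_def by (simp only:)
qed

text \<open>The assumed bound excludes the value infinity, the infimum of the empty set, so the
  conversion to a real in \<open>tstar\<close> loses nothing.\<close>

lemma hitting_time_eq_tstar:
  assumes \<xi>: "\<xi> \<in> E"
  shows "hitting_time E \<Phi> \<xi> = ereal (ts \<xi>)"
proof -
  obtain c :: real where c: "hitting_time E \<Phi> \<xi> \<le> ereal c"
    using hitting_time_bounded \<xi> by blast
  have "0 \<le> hitting_time E \<Phi> \<xi>"
    unfolding hitting_time_def by (rule Inf_greatest) auto
  with c show ?thesis
    by (cases "hitting_time E \<Phi> \<xi>") (simp_all add: tstar_def)
qed

section \<open>The interarrival law as a Stieltjes measure\<close>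

lemma interarrival_tail_eq:
  "\<xi> \<in> E \<Longrightarrow> interarrival_tail E \<Phi> rate \<xi> t = (if t < ts \<xi> then G \<xi> t else 0)"
  by (simp add: interarrival_tail_def hitting_time_eq_tstar)

definition cdf_T :: "'a \<Rightarrow> real \<Rightarrow> real" where
  "cdf_T \<xi> t = (if 0 \<le> t then 1 - interarrival_tail E \<Phi> rate \<xi> t else 0)"

abbreviation T :: "'a \<Rightarrow> real measure" where "T \<equiv> interarrival_law E \<Phi> rate"

lemma interarrival_law_eq_interval_measure: "T \<xi> = interval_measure (cdf_T \<xi>)"
  unfolding interarrival_law_def cdf_T_def ..

lemma cdf_T_mono:
  assumes \<xi>: "\<xi> \<in> E" and xy: "x \<le> y"
  shows "cdf_T \<xi> x \<le> cdf_T \<xi> y"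
  using xy surv_antimono[OF \<xi>, of x y] surv_le_1[OF \<xi>, of y] surv_pos[of \<xi> x]
  by (auto simp: cdf_T_def interarrival_tail_eq[OF \<xi>] less_imp_le)

text \<open>Right continuity is what lets \<open>interval_measure\<close> reproduce the distribution
  function. The critical point is \<open>ts \<xi>\<close>; the strict inequality in
  \<open>interarrival_tail\<close> makes the value there already the one after the jump.\<close>

lemma cdf_T_right_continuous:
  assumes \<xi>: "\<xi> \<in> E"
  shows "continuous (at_right a) (cdf_T \<xi>)"
  unfolding continuous_within
proof -
  consider "a < 0" | "0 \<le> a" "a < ts \<xi>" | "0 \<le> a" "ts \<xi> \<le> a" by linarith
  then show "(cdf_T \<xi> \<longlongrightarrow> cdf_T \<xi> a) (at_right a)"
  proof cases
    case 1
    have "\<forall>\<^sub>F x in at_right a. cdf_T \<xi> a = cdf_T \<xi> x"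
      using 1 by (intro eventually_at_rightI[of a 0]) (auto simp: cdf_T_def)
    then show ?thesis by (rule Lim_transform_eventually[OF tendsto_const])
  next
    case 2
    have "((\<lambda>x. 1 - G \<xi> x) \<longlongrightarrow> 1 - G \<xi> a) (at_right a)"
    proof (intro tendsto_intros)
      have "(G \<xi> \<longlongrightarrow> G \<xi> a) (at a within {0..})"
        using surv_continuous[OF \<xi>] 2 by (simp add: continuous_on_def)
      then show "(G \<xi> \<longlongrightarrow> G \<xi> a) (at_right a)"
        by (rule tendsto_within_subset) (use 2 in auto)
    qed
    moreover have "\<forall>\<^sub>F x in at_right a. 1 - G \<xi> x = cdf_T \<xi> x"
      using 2 by (intro eventually_at_rightI[of a "ts \<xi>"]) (auto simp: cdf_T_def interarrival_tail_eq[OF \<xi>])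
    moreover have "cdf_T \<xi> a = 1 - G \<xi> a"
      using 2 by (simp add: cdf_T_def interarrival_tail_eq[OF \<xi>])
    ultimately show ?thesis by (metis Lim_transform_eventually)
  next
    case 3
    have "\<forall>\<^sub>F x in at_right a. cdf_T \<xi> a = cdf_T \<xi> x"
      using 3 by (intro eventually_at_rightI[of a "a + 1"]) (auto simp: cdf_T_def interarrival_tail_eq[OF \<xi>])
    then show ?thesis by (rule Lim_transform_eventually[OF tendsto_const])
  qed
qed

lemma cdf_T_lim:
  assumes \<xi>: "\<xi> \<in> E"
  shows "(cdf_T \<xi> \<longlongrightarrow> 0) at_bot" "(cdf_T \<xi> \<longlongrightarrow> 1) at_top"
proof -
  have "\<forall>\<^sub>F x in at_bot. 0 = cdf_T \<xi> x"
    using eventually_gt_at_bot[of "0::real"] by eventually_elim (simp add: cdf_T_def)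
  then show "(cdf_T \<xi> \<longlongrightarrow> 0) at_bot" by (rule Lim_transform_eventually[OF tendsto_const])
  have "\<forall>\<^sub>F x in at_top. 1 = cdf_T \<xi> x"
    using eventually_ge_at_top[of "ts \<xi>"] eventually_ge_at_top[of 0]
    by eventually_elim (simp add: cdf_T_def interarrival_tail_eq[OF \<xi>])
  then show "(cdf_T \<xi> \<longlongrightarrow> 1) at_top" by (rule Lim_transform_eventually[OF tendsto_const])
qed

lemma sets_T[simp, measurable_cong]: "sets (T \<xi>) = sets borel"
  and space_T[simp]: "space (T \<xi>) = UNIV"
  by (simp_all add: interarrival_law_eq_interval_measure)

lemma prob_space_T: "\<xi> \<in> E \<Longrightarrow> prob_space (T \<xi>)"
  unfolding interarrival_law_eq_interval_measure
  using real_distribution_interval_measure[OF cdf_T_mono cdf_T_right_continuous cdf_T_lim]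
  by (simp add: real_distribution_def)

lemma emeasure_T_Iic: "\<xi> \<in> E \<Longrightarrow> emeasure (T \<xi>) {..t} = ennreal (cdf_T \<xi> t)"
  unfolding interarrival_law_eq_interval_measure
  by (rule emeasure_interval_measure_Iic[OF cdf_T_mono cdf_T_right_continuous cdf_T_lim(1)])

lemma emeasure_T_Ioc: "\<xi> \<in> E \<Longrightarrow> a \<le> b \<Longrightarrow> emeasure (T \<xi>) {a<..b} = ennreal (cdf_T \<xi> b - cdf_T \<xi> a)"
  unfolding interarrival_law_eq_interval_measure
  by (rule emeasure_interval_measure_Ioc[OF _ cdf_T_mono cdf_T_right_continuous])

lemma measure_T_Ioi:
  assumes \<xi>: "\<xi> \<in> E"
  shows "measure (T \<xi>) {t<..} = 1 - cdf_T \<xi> t"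
proof -
  interpret prob_space "T \<xi>" by (rule prob_space_T[OF \<xi>])
  have "0 \<le> cdf_T \<xi> t"
    using surv_le_1[OF \<xi>, of t] by (simp add: cdf_T_def interarrival_tail_eq[OF \<xi>])
  then have "measure (T \<xi>) {..t} = cdf_T \<xi> t"
    using emeasure_T_Iic[OF \<xi>, of t] by (simp add: measure_def)
  moreover have "{t<..} = space (T \<xi>) - {..t}" by auto
  moreover have "measure (T \<xi>) (space (T \<xi>) - {..t}) = 1 - measure (T \<xi>) {..t}"
    by (rule prob_compl) simp
  ultimately show ?thesis by (simp only:)
qed

lemma AE_T_nonneg:
  assumes \<xi>: "\<xi> \<in> E"
  shows "AE r in T \<xi>. 0 \<le> r"
proof -
  have "{.. - inverse (real (Suc n))} \<in> null_sets (T \<xi>)" for n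
    using emeasure_T_Iic[OF \<xi>, of "- inverse (real (Suc n))"] by (simp add: null_sets_def cdf_T_def)
  then have "(\<Union>n. {.. - inverse (real (Suc n))}) \<in> null_sets (T \<xi>)" by auto
  then show ?thesis
  proof (rule AE_I')
    show "{r \<in> space (T \<xi>). \<not> 0 \<le> r} \<subseteq> (\<Union>n. {.. - inverse (real (Suc n))})"
    proof
      fix r assume "r \<in> {r \<in> space (T \<xi>). \<not> 0 \<le> r}"
      then have "0 < - r" by simp
      then obtain n where "inverse (real (Suc n)) < - r" using reals_Archimedean by blast
      then show "r \<in> (\<Union>n. {.. - inverse (real (Suc n))})" by (intro UN_I[of n]) auto
    qed
  qed
qed

lemma T_kernel: "T \<in> state_space \<rightarrow>\<^sub>M prob_algebra borel"
proof (rule measurable_prob_algebra_generated[where \<Omega> = UNIV and G = "range atMost"])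
  show "sets borel = sigma_sets UNIV (range (atMost :: real \<Rightarrow> _))"
    by (simp add: borel_eq_atMost)
  show "Int_stable (range (atMost :: real \<Rightarrow> _))"
    by (auto simp: Int_stable_def)
  fix A :: "real set" assume "A \<in> range atMost"
  then obtain t where A: "A = {..t}" by auto
  have [measurable]: "hitting_time E \<Phi> \<in> borel_measurable state_space"
    by (rule hitting_time_measurable)
  have "(\<lambda>\<xi>. cdf_T \<xi> t) \<in> borel_measurable state_space"
  proof (cases "0 \<le> t")
    case True
    note [measurable] = surv_measurable[OF True]
    show ?thesis unfolding cdf_T_def interarrival_tail_def using True by simp
  qed (simp add: cdf_T_def)
  then have "(\<lambda>\<xi>. ennreal (cdf_T \<xi> t)) \<in> borel_measurable state_space" by simp
  then show "(\<lambda>\<xi>. emeasure (T \<xi>) A) \<in> borel_measurable state_space"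
    by (rule measurable_cong[THEN iffD1, rotated]) (simp add: A emeasure_T_Iic)
qed (auto simp: prob_space_T)

text \<open>The witness w is the integral from 0 of the dominating function. It does not depend on
  \<xi>, so increments of G can be averaged over states while keeping the same bound.\<close>

lemma rate_integral_modulus:
  "\<exists>w. (\<forall>t. continuous_on {0..t} w) \<and>
    (\<forall>\<xi>\<in>E. \<forall>s t. 0 \<le> s \<longrightarrow> s \<le> t \<longrightarrow> G \<xi> s - G \<xi> t \<le> w t - w s)"
proof -
  obtain B where B: "\<And>T. 0 \<le> T \<Longrightarrow> set_integrable lborel {0..T} B"
    "\<And>\<xi> t. \<xi> \<in> E \<Longrightarrow> 0 \<le> t \<Longrightarrow> rate (\<Phi> \<xi> t) \<le> B t"
    using rate_dominated by metis
  have Bi: "B integrable_on {0..t}" for t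
    using set_borel_integral_eq_integral(1)[OF B(1)[of t]] by (cases "0 \<le> t") auto
  show ?thesis
  proof (intro exI[of _ "\<lambda>t. integral {0..t} B"] conjI allI ballI impI)
    show "continuous_on {0..t} (\<lambda>t. integral {0..t} B)" for t
      by (rule indefinite_integral_continuous_1[OF Bi])
    fix \<xi> s t assume \<xi>: "\<xi> \<in> E" and st: "0 \<le> s" "s \<le> (t :: real)"
    let ?r = "\<lambda>s. rate (\<Phi> \<xi> s)"
    have ri: "?r integrable_on {0..t}"
      by (rule set_borel_integral_eq_integral(1)[OF set_integrable_rate[OF \<xi>]])
    have "integral {0..t} ?r - integral {0..s} ?r = integral {s..t} ?r"
      using Henstock_Kurzweil_Integration.integral_combine[OF st ri] by simp
    also have "\<dots> \<le> integral {s..t} B"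
      using st by (intro integral_le integrable_on_subinterval[OF ri] integrable_on_subinterval[OF Bi[of t]] B(2) \<xi>) auto
    also have "\<dots> = integral {0..t} B - integral {0..s} B"
      using Henstock_Kurzweil_Integration.integral_combine[OF st Bi] by simp
    finally show "G \<xi> s - G \<xi> t \<le> integral {0..t} B - integral {0..s} B"
      using surv_diff_le[OF \<xi> st] by simp
  qed
qed

section \<open>Integration against the interarrival law: density before \<open>ts\<close>, atom at
  \<open>ts\<close>\<close>

lemma nn_integral_T_Ioc:
  assumes \<xi>: "\<xi> \<in> E" and sb: "0 \<le> s" "s \<le> b" "b < ts \<xi>"
    and h[measurable]: "h \<in> borel_measurable borel"
  shows "(\<integral>\<^sup>+r. h r * indicator {s<..b} r \<partial>T \<xi>)
    = (\<integral>\<^sup>+r. ennreal (f \<xi> (max 0 r)) * h r * indicator {s<..b} r \<partial>lborel)"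
proof -
  note [measurable] = dens_measurable[OF \<xi>]
  interpret prob_space "T \<xi>" by (rule prob_space_T[OF \<xi>])
  let ?f = "\<lambda>r. ennreal (f \<xi> (max 0 r))"
  \<comment> \<open>Both measures are determined by half lines, to which they give increments of 1 -
    G; the condition \<open>b < ts \<xi>\<close> keeps the atom out.\<close>
  have "density (T \<xi>) (indicator {s<..b}) = density lborel (\<lambda>r. ?f r * indicator {s<..b} r)"
  proof (rule measure_eqI_generator_eq)
    show "Int_stable (range (atMost :: real \<Rightarrow> _))"
      by (auto simp: Int_stable_def)
    show "sets (density (T \<xi>) (indicator {s<..b})) = sigma_sets UNIV (range (atMost :: real \<Rightarrow> _))"
      "sets (density lborel (\<lambda>r. ?f r * indicator {s<..b} r)) = sigma_sets UNIV (range (atMost :: real \<Rightarrow> _))"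
      by (simp_all add: borel_eq_atMost)
    show "range (\<lambda>i::nat. {..real i}) \<subseteq> range atMost" by auto
    show "(\<Union>i::nat. {..real i}) = UNIV" by (auto simp: real_arch_simple)
    have eq: "emeasure (density (T \<xi>) (indicator {s<..b})) {..c} = emeasure (T \<xi>) {s<..min b c}" for c
      by (subst emeasure_density) (auto simp: indicator_inter_arith[symmetric] nn_integral_indicator
          intro!: arg_cong[of _ _ "emeasure (T \<xi>)"])
    then show "emeasure (density (T \<xi>) (indicator {s<..b})) {..real i} \<noteq> \<infinity>" for i :: nat
      by simp
    fix X :: "real set" assume "X \<in> range atMost"
    then obtain c where X: "X = {..c}" by auto
    have "emeasure (density lborel (\<lambda>r. ?f r * indicator {s<..b} r)) X
        = (\<integral>\<^sup>+r. ?f r * indicator {s<..min b c} r \<partial>lborel)"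
      unfolding X by (subst emeasure_density) (auto intro!: nn_integral_cong split: split_indicator)
    also have "\<dots> = emeasure (T \<xi>) {s<..min b c}"
    proof (cases "s \<le> c")
      case True
      have "(\<integral>\<^sup>+r. ?f r * indicator {s<..min b c} r \<partial>lborel)
          = (\<integral>\<^sup>+r. ?f r * indicator {s..min b c} r \<partial>lborel)"
        by (intro nn_integral_cong_AE eventually_mono[OF AE_lborel_singleton[of s]])
          (auto split: split_indicator)
      also have "\<dots> = ennreal (G \<xi> s - G \<xi> (min b c))"
        using True sb by (intro nn_integral_dens[OF \<xi>]) auto
      also have "\<dots> = emeasure (T \<xi>) {s<..min b c}"
        using True sb
        by (subst emeasure_T_Ioc[OF \<xi>]) (auto simp: cdf_T_def interarrival_tail_eq[OF \<xi>] min_def)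
      finally show ?thesis .
    qed simp
    finally show "emeasure (density (T \<xi>) (indicator {s<..b})) X
        = emeasure (density lborel (\<lambda>r. ?f r * indicator {s<..b} r)) X"
      by (simp add: X eq)
  qed simp
  then have "(\<integral>\<^sup>+r. h r \<partial>density (T \<xi>) (indicator {s<..b}))
      = (\<integral>\<^sup>+r. h r \<partial>density lborel (\<lambda>r. ?f r * indicator {s<..b} r))"
    by simp
  then show ?thesis
    by (subst (asm) (1 2) nn_integral_density) (simp_all add: mult.assoc mult.commute mult.left_commute)
qed

text \<open>The open interval is exhausted by half-open ones ending before the atom, and the
  measures with weight h are continuous from below.\<close>

lemma nn_integral_T_Ioo:
  assumes \<xi>: "\<xi> \<in> E" and s: "0 \<le> s" "s < ts \<xi>"
    and h[measurable]: "h \<in> borel_measurable borel"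
  shows "(\<integral>\<^sup>+r. h r * indicator {s<..<ts \<xi>} r \<partial>T \<xi>)
    = (\<integral>\<^sup>+r. ennreal (f \<xi> (max 0 r)) * h r * indicator {s<..<ts \<xi>} r \<partial>lborel)"
proof -
  note [measurable] = dens_measurable[OF \<xi>]
  \<comment> \<open>\<open>b 0 = s\<close>, and b increases to \<open>ts \<xi>\<close> without
    reaching it.\<close>
  define b where "b n = ts \<xi> - (ts \<xi> - s) * inverse (real (Suc n))" for n
  have b: "s \<le> b n" "b n < ts \<xi>" for n
  proof -
    have "(ts \<xi> - s) * inverse (real (Suc n)) \<le> (ts \<xi> - s) * 1"
      using s by (intro mult_left_mono) (auto simp: inverse_eq_divide)
    then show "s \<le> b n" by (simp add: b_def)
    show "b n < ts \<xi>" using s by (simp add: b_def)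
  qed
  have inc: "incseq (\<lambda>n. {s<..b n})"
  proof (rule incseq_SucI)
    fix n
    have "(ts \<xi> - s) * inverse (real (Suc (Suc n))) \<le> (ts \<xi> - s) * inverse (real (Suc n))"
      using s by (intro mult_left_mono le_imp_inverse_le) auto
    then have "b n \<le> b (Suc n)" by (simp add: b_def del: of_nat_Suc)
    then show "{s<..b n} \<subseteq> {s<..b (Suc n)}" by auto
  qed
  have un: "(\<Union>n. {s<..b n}) = {s<..<ts \<xi>}"
  proof (intro equalityI subsetI)
    fix r assume "r \<in> {s<..<ts \<xi>}"
    then have r: "s < r" "r < ts \<xi>" by auto
    then have "0 < (ts \<xi> - r) / (ts \<xi> - s)" by auto
    then obtain n where "inverse (real (Suc n)) < (ts \<xi> - r) / (ts \<xi> - s)"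
      using reals_Archimedean by blast
    then have "(ts \<xi> - s) * inverse (real (Suc n)) < ts \<xi> - r"
      using r s by (simp add: pos_less_divide_eq mult.commute del: of_nat_Suc)
    then have "r \<le> b n" by (simp add: b_def)
    then show "r \<in> (\<Union>n. {s<..b n})" using r by auto
  qed (use b in \<open>auto intro: order.strict_trans1\<close>)
  define m1 where "m1 = density (T \<xi>) h"
  define m2 where "m2 = density lborel (\<lambda>r. ennreal (f \<xi> (max 0 r)) * h r)"
  have "m1 {s<..b n} = m2 {s<..b n}" for n
    using nn_integral_T_Ioc[OF \<xi> s(1) b h, of n] unfolding m1_def m2_def
    by (simp add: emeasure_density)
  moreover have "(SUP n. m1 {s<..b n}) = m1 (\<Union>n. {s<..b n})" "(SUP n. m2 {s<..b n}) = m2 (\<Union>n. {s<..b n})"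
    using inc by (auto intro!: SUP_emeasure_incseq simp: m1_def m2_def)
  ultimately have "m1 {s<..<ts \<xi>} = m2 {s<..<ts \<xi>}" unfolding un by simp
  then show ?thesis unfolding m1_def m2_def by (simp add: emeasure_density)
qed

lemma nn_integral_dens_Ioo:
  assumes \<xi>: "\<xi> \<in> E" and s: "0 \<le> s" "s \<le> t"
  shows "(\<integral>\<^sup>+r. ennreal (f \<xi> (max 0 r)) * indicator {s<..<t} r \<partial>lborel) = ennreal (G \<xi> s - G \<xi> t)"
proof -
  have "(\<integral>\<^sup>+r. ennreal (f \<xi> (max 0 r)) * indicator {s<..<t} r \<partial>lborel)
      = (\<integral>\<^sup>+r. ennreal (f \<xi> (max 0 r)) * indicator {s..t} r \<partial>lborel)"
    by (intro nn_integral_cong_AE eventually_mono[OF eventually_conj[OF AE_lborel_singleton[of s] AE_lborel_singleton[of t]]])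
      (auto split: split_indicator)
  then show ?thesis using nn_integral_dens[OF \<xi> s] by simp
qed

text \<open>The mass of the atom is found by subtraction: the tail at s is G s, the open interval up
  to \<open>ts \<xi>\<close> carries G s - G (ts \<xi>), and nothing lies beyond
  \<open>ts \<xi>\<close>.\<close>

lemma nn_integral_T_Ioi:
  assumes \<xi>: "\<xi> \<in> E" and s: "0 \<le> s" "s < ts \<xi>"
    and h[measurable]: "h \<in> borel_measurable borel"
  shows "(\<integral>\<^sup>+r. h r * indicator {s<..} r \<partial>T \<xi>)
    = (\<integral>\<^sup>+r. ennreal (f \<xi> (max 0 r)) * h r * indicator {s<..<ts \<xi>} r \<partial>lborel) + ennreal (G \<xi> (ts \<xi>)) * h (ts \<xi>)"
proof -
  interpret prob_space "T \<xi>" by (rule prob_space_T[OF \<xi>])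
  have Ioo: "measure (T \<xi>) {s<..<ts \<xi>} = G \<xi> s - G \<xi> (ts \<xi>)"
  proof -
    have "emeasure (T \<xi>) {s<..<ts \<xi>} = ennreal (G \<xi> s - G \<xi> (ts \<xi>))"
      using nn_integral_T_Ioo[OF \<xi> s, of "\<lambda>_. 1"] nn_integral_dens_Ioo[OF \<xi>, of s "ts \<xi>"] s by simp
    then show ?thesis using surv_antimono[OF \<xi>, of s "ts \<xi>"] s by (simp add: measure_def)
  qed
  have "measure (T \<xi>) {s<..} = G \<xi> s"
    using s by (simp add: measure_T_Ioi[OF \<xi>] cdf_T_def interarrival_tail_eq[OF \<xi>])
  moreover have top: "measure (T \<xi>) {ts \<xi><..} = 0"
    using s by (simp add: measure_T_Ioi[OF \<xi>] cdf_T_def interarrival_tail_eq[OF \<xi>])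
  moreover have "measure (T \<xi>) {s<..} = measure (T \<xi>) {s<..<ts \<xi>} + measure (T \<xi>) {ts \<xi>} + measure (T \<xi>) {ts \<xi><..}"
  proof -
    have "measure (T \<xi>) {s<..} = measure (T \<xi>) (({s<..<ts \<xi>} \<union> {ts \<xi>}) \<union> {ts \<xi><..})"
      using s by (intro arg_cong[of _ _ "measure (T \<xi>)"]) auto
    also have "\<dots> = measure (T \<xi>) ({s<..<ts \<xi>} \<union> {ts \<xi>}) + measure (T \<xi>) {ts \<xi><..}"
      by (intro finite_measure_Union) auto
    also have "measure (T \<xi>) ({s<..<ts \<xi>} \<union> {ts \<xi>}) = measure (T \<xi>) {s<..<ts \<xi>} + measure (T \<xi>) {ts \<xi>}"
      by (intro finite_measure_Union) auto
    finally show ?thesis .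
  qed
  ultimately have atom: "emeasure (T \<xi>) {ts \<xi>} = ennreal (G \<xi> (ts \<xi>))"
    using Ioo by (simp add: emeasure_eq_measure)
  have "AE r in T \<xi>. r \<notin> {ts \<xi><..}"
    using top by (intro AE_not_in) (auto simp: null_sets_def emeasure_eq_measure)
  then have "(\<integral>\<^sup>+r. h r * indicator {s<..} r \<partial>T \<xi>)
      = (\<integral>\<^sup>+r. h r * indicator {s<..<ts \<xi>} r + h (ts \<xi>) * indicator {ts \<xi>} r \<partial>T \<xi>)"
    by (intro nn_integral_cong_AE, elim eventually_mono) (use s in \<open>auto split: split_indicator\<close>)
  also have "\<dots> = (\<integral>\<^sup>+r. h r * indicator {s<..<ts \<xi>} r \<partial>T \<xi>) + h (ts \<xi>) * emeasure (T \<xi>) {ts \<xi>}"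
    by (subst nn_integral_add) (auto simp: nn_integral_cmult_indicator)
  finally show ?thesis
    by (simp add: nn_integral_T_Ioo[OF \<xi> s h] atom mult.commute)
qed

section \<open>Transition densities and the transition kernel\<close>

lemma q_nonneg: "x \<in> E \<Longrightarrow> y \<in> E \<Longrightarrow> 0 \<le> s \<Longrightarrow> 0 \<le> q x s y"
  using q_lower_bound by (meson less_imp_le order_trans)

lemma q_max_measurable:
  "(\<lambda>z. q (fst z) (max 0 (fst (snd z))) (snd (snd z)))
    \<in> borel_measurable (state_space \<Otimes>\<^sub>M borel \<Otimes>\<^sub>M state_space)"
proof -
  have "(\<lambda>z. (fst z, max 0 (fst (snd z)), snd (snd z))) \<in> state_space \<Otimes>\<^sub>M borel \<Otimes>\<^sub>M state_space \<rightarrow>\<^sub>M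
      state_space \<Otimes>\<^sub>M restrict_space borel {0::real..} \<Otimes>\<^sub>M state_space"
    by (intro measurable_Pair measurable_fst measurable_compose[OF measurable_snd measurable_snd]
        measurable_restrict_space2[of "\<lambda>z. max 0 (fst (snd z))"]) auto
  from measurable_compose[OF this q_measurable] show ?thesis
    by (simp add: case_prod_beta')
qed

lemma q_time_measurable:
  "x \<in> E \<Longrightarrow> y \<in> E \<Longrightarrow> (\<lambda>r. q x (max 0 r) y) \<in> borel_measurable borel"
  by (intro borel_measurable_continuous_onI continuous_on_compose2[OF q_continuous] continuous_intros) auto

lemma q_time_state_measurable:
  assumes "x \<in> E"
  shows "(\<lambda>z. q x (max 0 (fst z)) (snd z)) \<in> borel_measurable (borel \<Otimes>\<^sub>M state_space)"
  using measurable_compose[OF measurable_Pair1' q_max_measurable, of x] assms by simp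

text \<open>
  The \<open>\<mu>\<close>-density of \<open>P\<^sub>x(S\<^sub>1 > s, Z\<^sub>1 \<in> dy)\<close>.  Since \<open>S\<^sub>1 \<ge> 0\<close>, the value \<open>s = -1\<close> removes the
  restriction on \<open>S\<^sub>1\<close> and gives the density of the transition kernel of \<open>(Z\<^sub>n)\<close>.
\<close>

definition tail_dens :: "real \<Rightarrow> 'a \<Rightarrow> 'a \<Rightarrow> ennreal" where
  "tail_dens s x y = (\<integral>\<^sup>+r. ennreal (q x (max 0 r) y) * indicator {s<..} r \<partial>T x)"

lemma tail_dens_measurable[measurable]:
  "(\<lambda>z. tail_dens s (fst z) (snd z)) \<in> borel_measurable (state_space \<Otimes>\<^sub>M state_space)"
proof -
  have "(\<lambda>z. integral\<^sup>N (T (fst z)) (\<lambda>r. ennreal (q (fst z) (max 0 r) (snd z)) * indicator {s<..} r))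
    \<in> borel_measurable (state_space \<Otimes>\<^sub>M state_space)"
  proof (rule nn_integral_measurable_subprob_algebra2[where N = borel])
    show "(\<lambda>z. T (fst z)) \<in> state_space \<Otimes>\<^sub>M state_space \<rightarrow>\<^sub>M subprob_algebra borel"
      by (rule measurable_compose[OF measurable_fst measurable_prob_algebraD[OF T_kernel]])
    have "(\<lambda>w. (fst (fst w), snd w, snd (fst w))) \<in> (state_space \<Otimes>\<^sub>M state_space) \<Otimes>\<^sub>M (borel :: real measure)
        \<rightarrow>\<^sub>M state_space \<Otimes>\<^sub>M borel \<Otimes>\<^sub>M state_space"
      by measurable
    from measurable_compose[OF this q_max_measurable]
    have [measurable]: "(\<lambda>w. q (fst (fst w)) (max 0 (snd w)) (snd (fst w)))
        \<in> borel_measurable ((state_space \<Otimes>\<^sub>M state_space) \<Otimes>\<^sub>M borel)"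
      by simp
    show "(\<lambda>(z, r). ennreal (q (fst z) (max 0 r) (snd z)) * indicator {s<..} r)
        \<in> borel_measurable ((state_space \<Otimes>\<^sub>M state_space) \<Otimes>\<^sub>M borel)"
      unfolding case_prod_beta' by measurable
  qed
  then show ?thesis by (simp add: tail_dens_def)
qed

lemma tail_dens_measurable2: "x \<in> E \<Longrightarrow> tail_dens s x \<in> borel_measurable state_space"
  using measurable_compose[OF measurable_Pair1' tail_dens_measurable, of x] by simp

lemma space_mu[simp]: "space \<mu> = E"
  using sets_eq_imp_space_eq[OF sets_mu] by simp

lemma Q_kernel_props:
  assumes z: "z \<in> closure E"
  shows "prob_space (Q z)" "sets (Q z) = sets (restrict_space borel (closure E))" "emeasure (Q z) E = 1"
proof -
  have "Q z \<in> space (prob_algebra (restrict_space borel (closure E)))"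
    using measurable_space[OF kernel_Q, of z] z by (simp add: space_restrict_space)
  then show *: "prob_space (Q z)" "sets (Q z) = sets (restrict_space borel (closure E))"
    by (auto simp: space_prob_algebra)
  interpret prob_space "Q z" by fact
  show "emeasure (Q z) E = 1" using Q_E[OF z] by (simp add: emeasure_eq_measure)
qed

text \<open>A probability density with respect to \<mu> that is at least m forces \<mu>(E) <= 1 / m.
  Finiteness of \<mu> is what later justifies exchanging integrals.\<close>

lemma emeasure_mu_finite: "emeasure \<mu> E \<noteq> \<infinity>"
proof -
  obtain m where m: "0 < m" "\<And>x y s. x \<in> E \<Longrightarrow> y \<in> E \<Longrightarrow> 0 \<le> s \<Longrightarrow> m \<le> q x s y"
    using q_lower_bound by blast
  obtain x where x: "x \<in> E" using nonempty_E by auto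
  have E: "E \<in> sets \<mu>" by (simp add: sets_mu sets_state_space_iff)
  have "ennreal m * emeasure \<mu> E = (\<integral>\<^sup>+y. ennreal m * indicator E y \<partial>\<mu>)"
    using E by (simp add: nn_integral_cmult_indicator)
  also have "\<dots> \<le> (\<integral>\<^sup>+y\<in>E. ennreal (q x 0 y) \<partial>\<mu>)"
    using m x by (intro nn_integral_mono) (auto intro!: ennreal_leI split: split_indicator)
  also have "\<dots> = emeasure (Q (\<Phi> x 0)) E"
    by (rule Q_density[symmetric, OF x _ E]) simp
  also have "\<dots> = 1" using Q_kernel_props(3)[OF flow_in_closure[OF x]] by simp
  finally show ?thesis using m(1) by (auto simp: ennreal_mult_top top_unique)
qed

sublocale mu: finite_measure \<mu>
  using emeasure_mu_finite by (intro finite_measureI) simp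

text \<open>Tonelli's theorem exchanges time and location. The density form leads to H and to the
  minorant, the kernel form to conditional probabilities.\<close>

lemma nn_integral_tail_dens:
  assumes x: "x \<in> E" and C: "C \<in> sets state_space"
  shows "(\<integral>\<^sup>+y\<in>C. tail_dens s x y \<partial>\<mu>)
    = (\<integral>\<^sup>+r. emeasure (Q (\<Phi> x (max 0 r))) C * indicator {s<..} r \<partial>T x)"
proof -
  interpret T: prob_space "T x" by (rule prob_space_T[OF x])
  interpret pair_sigma_finite "T x" \<mu> ..
  note [measurable_cong] = sets_mu
  note [measurable] = q_time_state_measurable[OF x] C
  have C\<mu>: "C \<in> sets \<mu>" using C by (simp add: sets_mu)
  have *: "(\<lambda>(r, y). ennreal (q x (max 0 r) y) * indicator {s<..} r * indicator C y)
      \<in> borel_measurable (T x \<Otimes>\<^sub>M \<mu>)"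
    unfolding case_prod_beta' by measurable
  have "(\<integral>\<^sup>+y\<in>C. tail_dens s x y \<partial>\<mu>)
      = (\<integral>\<^sup>+y. \<integral>\<^sup>+r. ennreal (q x (max 0 r) y) * indicator {s<..} r * indicator C y \<partial>T x \<partial>\<mu>)"
    unfolding tail_dens_def
    using q_time_measurable[OF x]
    by (intro nn_integral_cong nn_integral_multc[symmetric]) auto
  also have "\<dots> = (\<integral>\<^sup>+r. \<integral>\<^sup>+y. ennreal (q x (max 0 r) y) * indicator {s<..} r * indicator C y \<partial>\<mu> \<partial>T x)"
    by (rule Fubini'[OF *])
  also have "\<dots> = (\<integral>\<^sup>+r. (\<integral>\<^sup>+y\<in>C. ennreal (q x (max 0 r) y) \<partial>\<mu>) * indicator {s<..} r \<partial>T x)"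
    by (intro nn_integral_cong) (auto split: split_indicator)
  also have "\<dots> = (\<integral>\<^sup>+r. emeasure (Q (\<Phi> x (max 0 r))) C * indicator {s<..} r \<partial>T x)"
    using Q_density[OF x _ C\<mu>, of "max 0 _"] by simp
  finally show ?thesis .
qed

text \<open>\<open>chain_kernel\<close> is a mere set function in its last argument. As a density, K
  is a measure by construction, and a minorant of it comes from a pointwise bound on the density;
  the two agree by \<open>emeasure_K_eq_chain_kernel\<close>.\<close>

definition K :: "'a \<Rightarrow> 'a measure" where
  "K x = density \<mu> (tail_dens (- 1) x)"

lemma sets_K[simp]: "sets (K x) = sets state_space" and space_K[simp]: "space (K x) = E"
  by (simp_all add: K_def sets_mu)

lemma emeasure_K:
  assumes x: "x \<in> E" and C: "C \<in> sets state_space"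
  shows "emeasure (K x) C = (\<integral>\<^sup>+y\<in>C. tail_dens (- 1) x y \<partial>\<mu>)"
  unfolding K_def using tail_dens_measurable2[OF x] C
  by (subst emeasure_density) (auto simp: sets_mu cong: measurable_cong_sets)

lemma emeasure_K_eq_chain_kernel:
  assumes x: "x \<in> E" and C: "C \<in> sets state_space"
  shows "emeasure (K x) C = chain_kernel E \<Phi> rate Q x C"
  \<comment> \<open>One side integrates over r > -1, the other over r >= 0; the interarrival law
    gives no mass to the negative times where they differ.\<close>
  unfolding emeasure_K[OF assms] nn_integral_tail_dens[OF assms] chain_kernel_def
  by (intro nn_integral_cong_AE eventually_mono[OF AE_T_nonneg[OF x]])
    (auto simp: max_def split: split_indicator)

lemma K_kernel: "K \<in> state_space \<rightarrow>\<^sub>M prob_algebra state_space"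
proof (rule measurable_prob_algebraI)
  show "prob_space (K x)" if "x \<in> space state_space" for x
  proof (rule prob_spaceI)
    have x: "x \<in> E" using that by simp
    interpret T: prob_space "T x" by (rule prob_space_T[OF x])
    have "emeasure (K x) E = (\<integral>\<^sup>+r. emeasure (Q (\<Phi> x (max 0 r))) E * indicator {- 1<..} r \<partial>T x)"
      by (simp add: emeasure_K[OF x] nn_integral_tail_dens[OF x] sets_state_space_iff)
    also have "\<dots> = (\<integral>\<^sup>+r. 1 \<partial>T x)"
      using Q_kernel_props(3)[OF flow_in_closure[OF x]]
      by (intro nn_integral_cong_AE eventually_mono[OF AE_T_nonneg[OF x]]) auto
    finally show "emeasure (K x) (space (K x)) = 1" using T.emeasure_space_1 by simp
  qed
  show "K \<in> state_space \<rightarrow>\<^sub>M subprob_algebra state_space"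
  proof (rule measurable_subprob_algebra)
    fix x assume "x \<in> space state_space"
    then have "prob_space (K x)" by fact
    then show "subprob_space (K x)" by (rule prob_space_imp_subprob_space)
  next
    fix C assume C: "C \<in> sets state_space"
    note [measurable_cong] = sets_mu
    note [measurable] = C
    have "(\<lambda>x. \<integral>\<^sup>+y. tail_dens (- 1) x y * indicator C y \<partial>\<mu>) \<in> borel_measurable state_space"
      using tail_dens_measurable[of "- 1"]
      by (intro mu.borel_measurable_nn_integral) (auto simp: case_prod_beta')
    then show "(\<lambda>x. emeasure (K x) C) \<in> borel_measurable state_space"
      by (rule measurable_cong[THEN iffD1, rotated]) (simp add: emeasure_K C)
  qed simp
qed

text \<open>The witness is m times \<mu>: the bound q >= m survives averaging over the interarrival
  law, which has mass 1. The last clause serves to show that \<nu>(A) > 0.\<close>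

lemma K_minorization:
  obtains \<eta> where "sets \<eta> = sets state_space" "emeasure \<eta> (space \<eta>) \<noteq> 0"
    "\<And>x C. x \<in> E \<Longrightarrow> C \<in> sets state_space \<Longrightarrow> emeasure \<eta> C \<le> emeasure (K x) C"
    "\<And>C. C \<in> sets state_space \<Longrightarrow> interior C \<noteq> {} \<Longrightarrow> 0 < emeasure \<eta> C"
proof -
  obtain m where m: "0 < m" "\<And>x y s. x \<in> E \<Longrightarrow> y \<in> E \<Longrightarrow> 0 \<le> s \<Longrightarrow> m \<le> q x s y"
    using q_lower_bound by blast
  let ?\<eta> = "scale_measure (ennreal m) \<mu>"
  have pos: "0 < emeasure ?\<eta> C" if "C \<in> sets state_space" "interior C \<noteq> {}" for C
    using mu_pos[of C] that m(1) by (simp add: sets_mu ennreal_zero_less_mult_iff)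
  show thesis
  proof (rule that)
    show "sets ?\<eta> = sets state_space" by (simp add: sets_mu)
    show "emeasure ?\<eta> (space ?\<eta>) \<noteq> 0"
      using pos[of E] nonempty_E interior_open[OF open_E]
      by (simp add: space_scale_measure sets_state_space_iff del: emeasure_scale_measure)
    show "emeasure ?\<eta> C \<le> emeasure (K x) C" if x: "x \<in> E" and C: "C \<in> sets state_space" for x C
    proof -
      interpret T: prob_space "T x" by (rule prob_space_T[OF x])
      have "ennreal m \<le> tail_dens (- 1) x y" if y: "y \<in> E" for y
      proof -
        have "ennreal m = (\<integral>\<^sup>+r. ennreal m \<partial>T x)" using T.emeasure_space_1 by simp
        also have "\<dots> \<le> tail_dens (- 1) x y"
          unfolding tail_dens_def using m(2)[OF x y]
          by (intro nn_integral_mono_AE eventually_mono[OF AE_T_nonneg[OF x]])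
            (auto intro!: ennreal_leI split: split_indicator)
        finally show ?thesis .
      qed
      then have "(\<integral>\<^sup>+y. ennreal m * indicator C y \<partial>\<mu>) \<le> (\<integral>\<^sup>+y\<in>C. tail_dens (- 1) x y \<partial>\<mu>)"
        by (intro nn_integral_mono) (auto split: split_indicator)
      then show ?thesis
        using C by (simp add: emeasure_K[OF x C] sets_mu nn_integral_cmult_indicator)
    qed
  qed (rule pos)
qed

text \<open>The two summands of H are the contributions of the density and of the atom;
  \<open>s < ts x\<close> places the atom inside {s<..}.\<close>

lemma tail_dens_eq_H_fun:
  assumes x: "x \<in> E" and y: "y \<in> E" and s: "0 \<le> s" "s < ts x"
  shows "tail_dens s x y = ennreal (H_fun E \<Phi> rate q x y s)" and "0 \<le> H_fun E \<Phi> rate q x y s"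
proof -
  have nonneg: "0 \<le> f x r * q x r y" if "0 \<le> r" for r
    using dens_pos[OF x that] q_nonneg[OF x y that] by simp
  have "continuous_on {s..ts x} (\<lambda>r. f x r * q x r y)"
    using s by (intro continuous_intros continuous_on_subset[OF dens_continuous[OF x]]
        continuous_on_subset[OF q_continuous[OF x y]]) auto
  then have int: "set_integrable lborel {s..ts x} (\<lambda>r. f x r * q x r y)"
    by (rule borel_integrable_atLeastAtMost')
  \<comment> \<open>The law gives an open interval and H a closed one; endpoints are Lebesgue
    null.\<close>
  have "(\<integral>\<^sup>+r. ennreal (f x (max 0 r)) * ennreal (q x (max 0 r) y) * indicator {s<..<ts x} r \<partial>lborel)
      = (\<integral>\<^sup>+r. ennreal (indicator {s..ts x} r *\<^sub>R (f x r * q x r y)) \<partial>lborel)"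
    using s dens_pos[OF x]
    by (intro nn_integral_cong_AE eventually_mono[OF eventually_conj[OF AE_lborel_singleton[of s] AE_lborel_singleton[of "ts x"]]])
      (auto simp: max_def ennreal_mult' less_imp_le split: split_indicator)
  also have "\<dots> = ennreal (LBINT r:{s..ts x}. f x r * q x r y)"
    using int nonneg s unfolding set_integrable_def set_lebesgue_integral_def
    by (intro nn_integral_eq_integral) (auto split: split_indicator)
  finally have "tail_dens s x y = ennreal (LBINT r:{s..ts x}. f x r * q x r y)
      + ennreal (G x (ts x)) * ennreal (q x (max 0 (ts x)) y)"
    unfolding tail_dens_def using q_time_measurable[OF x y]
    by (subst nn_integral_T_Ioi[OF x s]) auto
  moreover have I: "0 \<le> (LBINT r:{s..ts x}. f x r * q x r y)"
    using nonneg s unfolding set_lebesgue_integral_def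
    by (intro integral_nonneg_AE) (auto split: split_indicator)
  moreover have b: "0 \<le> G x (ts x)" "0 \<le> q x (ts x) y"
    using surv_pos[of x "ts x"] q_nonneg[OF x y] s by auto
  ultimately show "tail_dens s x y = ennreal (H_fun E \<Phi> rate q x y s)"
    using s by (simp add: H_fun_def max_def ennreal_mult' ennreal_plus)
  show "0 \<le> H_fun E \<Phi> rate q x y s"
    using I b by (simp add: H_fun_def)
qed

end

section \<open>The embedded chain\<close>

lemma sigma_vimage_measurable:
  assumes "\<A> \<subseteq> Pow \<Omega>" "\<And>C. C \<in> sets N \<Longrightarrow> X -` C \<inter> \<Omega> \<in> \<A>" "X \<in> \<Omega> \<rightarrow> space N"
  shows "X \<in> sigma \<Omega> \<A> \<rightarrow>\<^sub>M N"
  using assms by (intro measurableI) (auto simp: space_measure_of_conv)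

lemma p_hat_antimono: "s \<le> t \<Longrightarrow> p_hat Z S n A B t \<omega> \<le> p_hat Z S n A B s \<omega>"
  unfolding p_hat_def
  by (intro divide_right_mono sum_mono mult_right_mono sum_nonneg) (auto split: split_indicator)

locale regular_chain = regular_pdmp E \<Phi> rate Q \<mu> q + embedded_chain M E \<Phi> rate Q Z S
  for E :: "'a::{metric_space, second_countable_topology} set"
    and \<Phi> :: "'a \<Rightarrow> real \<Rightarrow> 'a"
    and rate :: "'a \<Rightarrow> real"
    and Q :: "'a \<Rightarrow> 'a measure"
    and \<mu> :: "'a measure"
    and q :: "'a \<Rightarrow> real \<Rightarrow> 'a \<Rightarrow> real"
    and M :: "'w measure"
    and Z :: "nat \<Rightarrow> 'w \<Rightarrow> 'a"
    and S :: "nat \<Rightarrow> 'w \<Rightarrow> real"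
begin

section \<open>Filtrations of the chain, with an intermediate stage where the next interarrival time
  is known\<close>

abbreviation past :: "nat \<Rightarrow> 'w measure" where "past \<equiv> history M Z S"

abbreviation past' :: "nat \<Rightarrow> 'w measure" where "past' \<equiv> history_next_time M Z S"

lemma Z_borel[measurable]: "Z n \<in> M \<rightarrow>\<^sub>M borel"
  by (rule measurable_restrict_space2_iff[THEN iffD1, OF Z_measurable, THEN conjunct1])

lemma Z_in_E: "\<omega> \<in> space M \<Longrightarrow> Z n \<omega> \<in> E"
  using measurable_space[OF Z_measurable] by simp

lemma S_borel[measurable]: "S n \<in> M \<rightarrow>\<^sub>M borel"
  by (rule measurable_restrict_space2_iff[THEN iffD1, OF S_measurable, THEN conjunct1])

lemma S_nonneg: "\<omega> \<in> space M \<Longrightarrow> 0 \<le> S n \<omega>"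
  using measurable_space[OF S_measurable, of \<omega> n] by (simp add: space_restrict_space)

lemma history_gen_sets: "history_gen M Z S n \<subseteq> sets M"
  by (auto simp: history_gen_def intro!: measurable_sets[OF Z_borel] measurable_sets[OF S_borel])

lemma history_gen_Pow: "history_gen M Z S n \<subseteq> Pow (space M)"
  using history_gen_sets sets.sets_into_space by blast

lemma next_time_gen_sets: "{S (Suc n) -` C \<inter> space M | C. C \<in> sets borel} \<subseteq> sets M"
  by (auto intro!: measurable_sets[OF S_borel])

lemma next_time_gen_Pow: "{S (Suc n) -` C \<inter> space M | C. C \<in> sets borel} \<subseteq> Pow (space M)"
  by auto

lemma sets_past: "sets (past n) = sigma_sets (space M) (history_gen M Z S n)"
  unfolding history_def using history_gen_Pow by simp

lemma sets_past': "sets (past' n) =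
    sigma_sets (space M) (history_gen M Z S n \<union> {S (Suc n) -` C \<inter> space M | C. C \<in> sets borel})"
  unfolding history_next_time_def using history_gen_Pow next_time_gen_Pow by (intro sets_measure_of) auto

lemma space_past[simp]: "space (past n) = space M" and space_past'[simp]: "space (past' n) = space M"
  by (simp_all add: history_def history_next_time_def space_measure_of_conv)

lemma subalgebra_past: "subalgebra M (past n)"
  unfolding subalgebra_def sets_past using history_gen_sets by (auto intro!: sets.sigma_sets_subset)

lemma subalgebra_past': "subalgebra M (past' n)"
  unfolding subalgebra_def sets_past' using history_gen_sets next_time_gen_sets
  by (auto intro!: sets.sigma_sets_subset)

lemma subalgebra_past_past': "subalgebra (past' n) (past n)"
  unfolding subalgebra_def sets_past' sets_past by (auto intro!: sigma_sets_mono')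

lemma sets_past_mono: "i \<le> j \<Longrightarrow> sets (past i) \<subseteq> sets (past j)"
  unfolding sets_past history_gen_def by (intro sigma_sets_mono' UN_mono) auto

lemma Z_past: "i \<le> n \<Longrightarrow> Z i \<in> past n \<rightarrow>\<^sub>M state_space"
proof (rule measurable_restrict_space2)
  show "Z i \<in> space (past n) \<rightarrow> E" by (auto intro: Z_in_E)
  assume "i \<le> n"
  then show "Z i \<in> borel_measurable (past n)"
    unfolding history_def
    by (intro sigma_vimage_measurable history_gen_Pow) (auto simp: history_gen_def)
qed

lemma S_past: "i \<le> n \<Longrightarrow> S i \<in> borel_measurable (past n)"
  unfolding history_def
  by (intro sigma_vimage_measurable history_gen_Pow) (auto simp: history_gen_def)

lemma S_past': "S (Suc n) \<in> borel_measurable (past' n)"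
  unfolding history_next_time_def
  by (intro sigma_vimage_measurable) (use history_gen_Pow in auto)

lemma finite_measure_subalgebra_past: "finite_measure_subalgebra M (past n)"
  by (intro finite_measure_subalgebra.intro finite_measure_subalgebra_axioms.intro
      subalgebra_past finite_measure_axioms)

lemma finite_measure_subalgebra_past': "finite_measure_subalgebra M (past' n)"
  by (intro finite_measure_subalgebra.intro finite_measure_subalgebra_axioms.intro
      subalgebra_past' finite_measure_axioms)

section \<open>Conditional law of the next jump\<close>

definition jump_prob :: "'a set \<Rightarrow> 'a \<Rightarrow> real \<Rightarrow> real" where
  "jump_prob C x r = measure (Q (\<Phi> x (max 0 r))) C"

lemma sets_closure_space: "C \<in> sets state_space \<Longrightarrow> C \<in> sets (restrict_space borel (closure E))"
  using closure_subset[of E] by (auto simp: sets_state_space_iff sets_restrict_space_iff)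

lemma jump_prob_measurable:
  assumes C: "C \<in> sets state_space"
  shows "(\<lambda>z. jump_prob C (fst z) (snd z)) \<in> borel_measurable (state_space \<Otimes>\<^sub>M borel)"
  unfolding jump_prob_def
  using measurable_compose[OF measurable_compose[OF flow_max_measurable kernel_Q]
      measurable_measure_prob_algebra[OF sets_closure_space[OF C]]] .

lemma jump_prob_bounds:
  assumes "x \<in> E" shows "0 \<le> jump_prob C x r" "jump_prob C x r \<le> 1"
  unfolding jump_prob_def
  using prob_space.prob_le_1[OF Q_kernel_props(1)[OF flow_in_closure[OF assms]]] by auto

text \<open>The chain assumptions give tails at levels t >= 0. Adding the tails at negative levels
  and the whole line yields an intersection-stable generator; the added sets have conditional
  probability 1 because interarrival times are nonnegative.\<close>

lemma cond_exp_interarrival_kernel: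
  fixes \<psi> :: "'a \<Rightarrow> real \<Rightarrow> real"
  assumes \<psi>: "(\<lambda>(x, r). \<psi> x r) \<in> borel_measurable (state_space \<Otimes>\<^sub>M borel)"
    and bound: "\<And>x r. x \<in> E \<Longrightarrow> \<bar>\<psi> x r\<bar> \<le> c"
  shows "AE \<omega> in M. real_cond_exp M (past n) (\<lambda>\<omega>. \<psi> (Z n \<omega>) (S (Suc n) \<omega>)) \<omega>
    = (\<integral>r. \<psi> (Z n \<omega>) r \<partial>T (Z n \<omega>))"
proof (rule real_cond_exp_eq_kernel_integral[OF subalgebra_past Z_past[OF order_refl] S_borel T_kernel,
      where G = "insert UNIV (range greaterThan)"])
  interpret P: finite_measure_subalgebra M "past n" by (rule finite_measure_subalgebra_past)
  show "Int_stable (insert UNIV (range (greaterThan :: real \<Rightarrow> _)))"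
  proof (rule Int_stableI)
    fix a b :: "real set"
    assume "a \<in> insert UNIV (range greaterThan)" "b \<in> insert UNIV (range greaterThan)"
    then show "a \<inter> b \<in> insert UNIV (range greaterThan)"
    proof (elim insertE imageE)
      fix u v :: real assume "a = {u<..}" "b = {v<..}"
      then have "a \<inter> b = {max u v<..}" by auto
      then show ?thesis by blast
    qed auto
  qed
  show "sets borel = sigma_sets (space borel) (insert UNIV (range (greaterThan :: real \<Rightarrow> _)))"
  proof -
    have "sets (borel :: real measure) = sigma_sets UNIV (range greaterThan)"
      by (subst borel_Ioi) simp
    also have "\<dots> = sigma_sets UNIV (insert UNIV (range greaterThan))"
      by (intro sigma_sets_eqI) (auto intro: sigma_sets_top sigma_sets.Basic)
    finally show ?thesis by simp
  qed
  fix C :: "real set" assume C: "C \<in> insert UNIV (range greaterThan)"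
  then have [measurable]: "C \<in> sets borel" by auto
  consider t where "0 \<le> t" "C = {t<..}" | "{0..} \<subseteq> C"
  proof -
    have "C = UNIV \<or> (\<exists>t. C = {t<..})" using C by auto
    moreover have "{0..} \<subseteq> {t<..}" if "t < 0" for t :: real using that by auto
    ultimately show thesis using that by (metis not_le subset_UNIV)
  qed
  then show "AE \<omega> in M. real_cond_exp M (past n) (\<lambda>\<omega>. indicator C (S (Suc n) \<omega>)) \<omega>
      = measure (T (Z n \<omega>)) C"
  proof cases
    case 1
    have mT: "measure (T x) C = interarrival_tail E \<Phi> rate x t" if "x \<in> E" for x
      using 1 by (simp add: measure_T_Ioi[OF that] cdf_T_def)
    have "AE \<omega> in M. real_cond_exp M (past n) (\<lambda>\<omega>. indicator C (S (Suc n) \<omega>)) \<omega>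
        = real_cond_exp M (past n) (indicator {\<omega>\<in>space M. t < S (Suc n) \<omega>}) \<omega>"
      using 1 by (intro P.real_cond_exp_cong) (auto intro!: AE_I2 split: split_indicator)
    then show ?thesis
      using cond_interarrival[OF 1(1), of n] AE_space[of M] by eventually_elim (simp add: Z_in_E mT)
  next
    case 2
    have mT: "measure (T x) C = 1" if "x \<in> E" for x
    proof -
      interpret T: prob_space "T x" by (rule prob_space_T[OF that])
      show ?thesis
        using AE_T_nonneg[OF that] 2 by (subst T.prob_eq_1) (auto elim: eventually_mono)
    qed
    have "AE \<omega> in M. real_cond_exp M (past n) (\<lambda>\<omega>. indicator C (S (Suc n) \<omega>)) \<omega>
        = real_cond_exp M (past n) (\<lambda>\<omega>. 1) \<omega>"
      using 2 S_nonneg by (intro P.real_cond_exp_cong) (auto intro!: AE_I2 split: split_indicator)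
    moreover have "AE \<omega> in M. real_cond_exp M (past n) (\<lambda>\<omega>. 1) \<omega> = 1"
      by (rule P.real_cond_exp_F_meas) auto
    ultimately show ?thesis
      using AE_space[of M] by eventually_elim (simp add: Z_in_E mT)
  qed
qed (use assms in auto)

text \<open>This is P_x(S_1 > s, Z_1 in C). The integral is finite by
  \<open>transition_tail_eq\<close>, so \<open>enn2real\<close> loses nothing.\<close>

definition transition_tail :: "real \<Rightarrow> 'a set \<Rightarrow> 'a \<Rightarrow> real" where
  "transition_tail s C x = enn2real (\<integral>\<^sup>+y\<in>C. tail_dens s x y \<partial>\<mu>)"

lemma transition_tail_eq:
  assumes x: "x \<in> E" and C: "C \<in> sets state_space"
  shows "(\<integral>\<^sup>+y\<in>C. tail_dens s x y \<partial>\<mu>) = ennreal (transition_tail s C x)"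
    and "(\<integral>r. indicator {s<..} r * jump_prob C x r \<partial>T x) = transition_tail s C x"
    and "transition_tail s C x \<le> measure (T x) {s<..}"
proof -
  interpret T: prob_space "T x" by (rule prob_space_T[OF x])
  have j[measurable]: "jump_prob C x \<in> borel_measurable borel"
    using measurable_compose[OF measurable_Pair1' jump_prob_measurable[OF C], of x] x by simp
  have "(\<integral>\<^sup>+y\<in>C. tail_dens s x y \<partial>\<mu>) = (\<integral>\<^sup>+r. ennreal (indicator {s<..} r * jump_prob C x r) \<partial>T x)"
    unfolding nn_integral_tail_dens[OF x C]
  proof (intro nn_integral_cong)
    fix r
    interpret Q: prob_space "Q (\<Phi> x (max 0 r))"
      by (rule Q_kernel_props(1)[OF flow_in_closure[OF x]]) simp
    show "emeasure (Q (\<Phi> x (max 0 r))) C * indicator {s<..} r = ennreal (indicator {s<..} r * jump_prob C x r)"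
      by (auto simp: jump_prob_def Q.emeasure_eq_measure split: split_indicator)
  qed
  also have "\<dots> = ennreal (\<integral>r. indicator {s<..} r * jump_prob C x r \<partial>T x)"
    using jump_prob_bounds[OF x]
    by (intro nn_integral_eq_integral T.integrable_const_bound[of _ 1]) (auto split: split_indicator)
  finally have eq: "(\<integral>\<^sup>+y\<in>C. tail_dens s x y \<partial>\<mu>) = ennreal (\<integral>r. indicator {s<..} r * jump_prob C x r \<partial>T x)" .
  have "0 \<le> (\<integral>r. indicator {s<..} r * jump_prob C x r \<partial>T x)"
    using jump_prob_bounds[OF x] by (intro integral_nonneg_AE) auto
  then show *: "(\<integral>r. indicator {s<..} r * jump_prob C x r \<partial>T x) = transition_tail s C x"
    unfolding transition_tail_def eq by simp
  show "(\<integral>\<^sup>+y\<in>C. tail_dens s x y \<partial>\<mu>) = ennreal (transition_tail s C x)"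
    unfolding eq * ..
  have "(\<integral>r. indicator {s<..} r * jump_prob C x r \<partial>T x) \<le> (\<integral>r. indicator {s<..} r \<partial>T x)"
    using jump_prob_bounds[OF x]
    by (intro integral_mono T.integrable_const_bound[of _ 1]) (auto split: split_indicator)
  then show "transition_tail s C x \<le> measure (T x) {s<..}"
    by (simp add: *)
qed

text \<open>Tower property: given also S_(n+1), its indicator is known and the location follows Q
  along the flow; conditioning that result on \<open>past n\<close> integrates it against the
  interarrival law.\<close>

lemma cond_exp_jump:
  assumes C: "C \<in> sets state_space"
  shows "AE \<omega> in M. real_cond_exp M (past n)
      (\<lambda>\<omega>. indicator {s<..} (S (Suc n) \<omega>) * indicator C (Z (Suc n) \<omega>)) \<omega>
    = transition_tail s C (Z n \<omega>)"
proof -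
  interpret P: finite_measure_subalgebra M "past n" by (rule finite_measure_subalgebra_past)
  interpret P': finite_measure_subalgebra M "past' n" by (rule finite_measure_subalgebra_past')
  have Cb[measurable]: "C \<in> sets borel" using C by (simp add: sets_state_space_iff)
  let ?X = "\<lambda>\<omega>. indicator {s<..} (S (Suc n) \<omega>) * indicator C (Z (Suc n) \<omega>) :: real"
  let ?\<psi> = "\<lambda>x r. indicator {s<..} r * jump_prob C x r"
  note [measurable] = jump_prob_measurable[OF C]
  have \<psi>: "(\<lambda>(x, r). ?\<psi> x r) \<in> borel_measurable (state_space \<Otimes>\<^sub>M borel)"
    unfolding case_prod_beta' by measurable
  have \<psi>M: "(\<lambda>\<omega>. ?\<psi> (Z n \<omega>) (S (Suc n) \<omega>)) \<in> borel_measurable M"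
    using measurable_compose[OF measurable_Pair[OF Z_measurable S_borel] \<psi>] by simp
  have "AE \<omega> in M. real_cond_exp M (past' n) ?X \<omega>
      = indicator {s<..} (S (Suc n) \<omega>) * real_cond_exp M (past' n) (\<lambda>\<omega>. indicator C (Z (Suc n) \<omega>)) \<omega>"
    using S_past'[of n]
    by (intro P'.real_cond_exp_mult integrable_const_bound[of _ 1]) (auto split: split_indicator)
  moreover have "AE \<omega> in M. real_cond_exp M (past' n) (\<lambda>\<omega>. indicator C (Z (Suc n) \<omega>)) \<omega>
      = real_cond_exp M (past' n) (indicator {\<omega>\<in>space M. Z (Suc n) \<omega> \<in> C}) \<omega>"
    by (intro P'.real_cond_exp_cong) (auto intro!: AE_I2 split: split_indicator)
  moreover note cond_location[OF C, of n]
  ultimately have "AE \<omega> in M. real_cond_exp M (past' n) ?X \<omega> = ?\<psi> (Z n \<omega>) (S (Suc n) \<omega>)"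
    using AE_space[of M] by eventually_elim (simp add: jump_prob_def S_nonneg max_def)
  then have "AE \<omega> in M. real_cond_exp M (past n) (real_cond_exp M (past' n) ?X) \<omega>
      = real_cond_exp M (past n) (\<lambda>\<omega>. ?\<psi> (Z n \<omega>) (S (Suc n) \<omega>)) \<omega>"
    using \<psi>M by (intro P.real_cond_exp_cong) auto
  moreover have "AE \<omega> in M. real_cond_exp M (past n) (real_cond_exp M (past' n) ?X) \<omega>
      = real_cond_exp M (past n) ?X \<omega>"
    by (intro P.real_cond_exp_nested_subalg subalgebra_past' subalgebra_past_past' integrable_const_bound[of _ 1])
      (auto split: split_indicator)
  moreover have "AE \<omega> in M. real_cond_exp M (past n) (\<lambda>\<omega>. ?\<psi> (Z n \<omega>) (S (Suc n) \<omega>)) \<omega>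
      = (\<integral>r. ?\<psi> (Z n \<omega>) r \<partial>T (Z n \<omega>))"
    using jump_prob_bounds
    by (intro cond_exp_interarrival_kernel[OF \<psi>, of 1]) (auto split: split_indicator)
  ultimately show ?thesis
    using AE_space[of M] by eventually_elim (simp add: transition_tail_eq(2)[OF Z_in_E C])
qed

lemma measure_K:
  assumes "x \<in> E" "C \<in> sets state_space" shows "measure (K x) C = transition_tail (- 1) C x"
  using emeasure_K[OF assms] by (simp add: measure_def transition_tail_def)

lemma markov_past:
  assumes C: "C \<in> sets state_space"
  shows "AE \<omega> in M. real_cond_exp M (past n) (\<lambda>\<omega>. indicator C (Z (Suc n) \<omega>)) \<omega> = measure (K (Z n \<omega>)) C"
proof -
  interpret P: finite_measure_subalgebra M "past n" by (rule finite_measure_subalgebra_past)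
  have [measurable]: "C \<in> sets borel" using C by (simp add: sets_state_space_iff)
  \<comment> \<open>Interarrival times are nonnegative, so S > -1 always holds and the Markov
    property is the case s = -1 of the jump formula.\<close>
  have "AE \<omega> in M. real_cond_exp M (past n) (\<lambda>\<omega>. indicator C (Z (Suc n) \<omega>)) \<omega>
      = real_cond_exp M (past n) (\<lambda>\<omega>. indicator {- 1<..} (S (Suc n) \<omega>) * indicator C (Z (Suc n) \<omega>)) \<omega>"
    using S_nonneg by (intro P.real_cond_exp_cong) (auto intro!: AE_I2 intro: order.strict_trans2[of _ 0] split: split_indicator)
  then show ?thesis
    using cond_exp_jump[OF C, of n "- 1"] AE_space[of M]
    by eventually_elim (simp add: measure_K[OF Z_in_E C])
qed

lemma transition_tail_measurable:
  assumes "C \<in> sets state_space"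
  shows "transition_tail s C \<in> borel_measurable state_space"
proof -
  note [measurable_cong] = sets_mu
  note [measurable] = assms
  have "(\<lambda>x. \<integral>\<^sup>+y. tail_dens s x y * indicator C y \<partial>\<mu>) \<in> borel_measurable state_space"
    using tail_dens_measurable[of s]
    by (intro mu.borel_measurable_nn_integral) (auto simp: case_prod_beta')
  then show ?thesis unfolding transition_tail_def[abs_def] by measurable
qed

lemma transition_tail_bounds:
  assumes "x \<in> E" "C \<in> sets state_space"
  shows "0 \<le> transition_tail s C x" "transition_tail s C x \<le> 1"
proof -
  show "0 \<le> transition_tail s C x" by (simp add: transition_tail_def)
  interpret T: prob_space "T x" by (rule prob_space_T[OF assms(1)])
  show "transition_tail s C x \<le> 1"
    using transition_tail_eq(3)[OF assms] T.prob_le_1 by (rule order_trans)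
qed

text \<open>The difference is P_x(s < S_1 <= t, Z_1 in C), at most P_x(s < S_1 <= t). With
  \<open>t < ts x\<close> the atom is avoided and this probability is an increment of G.\<close>

lemma transition_tail_diff:
  assumes x: "x \<in> E" and C: "C \<in> sets state_space" and st: "0 \<le> s" "s \<le> t" "t < ts x"
  shows "\<bar>transition_tail s C x - transition_tail t C x\<bar> \<le> G x s - G x t"
proof -
  interpret T: prob_space "T x" by (rule prob_space_T[OF x])
  have [measurable]: "jump_prob C x \<in> borel_measurable borel"
    using measurable_compose[OF measurable_Pair1' jump_prob_measurable[OF C], of x] x by simp
  have i: "integrable (T x) (\<lambda>r. indicator D r * jump_prob C x r)" if "D \<in> sets borel" for D
    using jump_prob_bounds[OF x] that
    by (intro T.integrable_const_bound[of _ 1]) (auto split: split_indicator)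
  have "transition_tail s C x - transition_tail t C x
      = (\<integral>r. indicator {s<..} r * jump_prob C x r - indicator {t<..} r * jump_prob C x r \<partial>T x)"
    using i by (simp add: transition_tail_eq(2)[OF x C])
  also have "\<dots> = (\<integral>r. indicator {s<..t} r * jump_prob C x r \<partial>T x)"
    using st by (intro Bochner_Integration.integral_cong) (auto split: split_indicator)
  finally have eq: "transition_tail s C x - transition_tail t C x
      = (\<integral>r. indicator {s<..t} r * jump_prob C x r \<partial>T x)" .
  have "(\<integral>r. indicator {s<..t} r * jump_prob C x r \<partial>T x) \<le> (\<integral>r. indicator {s<..t} r \<partial>T x)"
    using jump_prob_bounds[OF x] i
    by (intro integral_mono T.integrable_const_bound[of _ 1]) (auto split: split_indicator)
  also have "\<dots> = measure (T x) {s<..t}" by simp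
  also have "\<dots> = G x s - G x t"
    using st surv_antimono[OF x, of s t]
    by (simp add: measure_def emeasure_T_Ioc[OF x] cdf_T_def interarrival_tail_eq[OF x])
  finally have "transition_tail s C x - transition_tail t C x \<le> G x s - G x t" unfolding eq .
  moreover have "0 \<le> transition_tail s C x - transition_tail t C x"
    unfolding eq using jump_prob_bounds[OF x] by (intro integral_nonneg_AE) auto
  ultimately show ?thesis by simp
qed

section \<open>The invariant law, the pointwise limit of the estimator and its continuity\<close>

context
  fixes \<nu> :: "'a measure"
  assumes \<nu>: "invariant_prob E \<Phi> rate Q \<nu>"
begin

lemma prob_space_nu: "prob_space \<nu>" and sets_nu: "sets \<nu> = sets state_space"
  and nu_K: "C \<in> sets state_space \<Longrightarrow> (\<integral>\<^sup>+x. emeasure (K x) C \<partial>\<nu>) = emeasure \<nu> C"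
proof -
  show *: "prob_space \<nu>" "sets \<nu> = sets state_space"
    using \<nu> by (auto simp: invariant_prob_def)
  assume C: "C \<in> sets state_space"
  have "(\<integral>\<^sup>+x. emeasure (K x) C \<partial>\<nu>) = (\<integral>\<^sup>+x. chain_kernel E \<Phi> rate Q x C \<partial>\<nu>)"
    using sets_eq_imp_space_eq[OF *(2)] C
    by (intro nn_integral_cong) (simp add: emeasure_K_eq_chain_kernel)
  also have "\<dots> = emeasure \<nu> C" using \<nu> C by (simp add: invariant_prob_def)
  finally show "(\<integral>\<^sup>+x. emeasure (K x) C \<partial>\<nu>) = emeasure \<nu> C" .
qed

lemma space_nu: "space \<nu> = E"
  using sets_eq_imp_space_eq[OF sets_nu] by simp

text \<open>Integrating the minorization against \<nu> and using invariance gives \<nu>(C) >=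
  \<eta>(C) > 0. This makes the limit of the denominator of the estimator nonzero.\<close>

lemma measure_nu_pos:
  assumes C: "C \<in> class_C1 E"
  shows "0 < measure \<nu> C"
proof -
  interpret \<nu>: prob_space \<nu> by (rule prob_space_nu)
  have Cs: "C \<in> sets state_space" "interior C \<noteq> {}"
    using C by (auto simp: class_C1_def sets_state_space_iff)
  obtain \<eta> where \<eta>: "sets \<eta> = sets state_space" "emeasure \<eta> (space \<eta>) \<noteq> 0"
    "\<And>x C. x \<in> E \<Longrightarrow> C \<in> sets state_space \<Longrightarrow> emeasure \<eta> C \<le> emeasure (K x) C"
    "\<And>C. C \<in> sets state_space \<Longrightarrow> interior C \<noteq> {} \<Longrightarrow> 0 < emeasure \<eta> C"
    by (rule K_minorization) (rule that; blast)
  have "0 < emeasure \<eta> C" using \<eta>(4)[OF Cs] .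
  also have "\<dots> = (\<integral>\<^sup>+x. emeasure \<eta> C \<partial>\<nu>)" by (simp add: \<nu>.emeasure_space_1)
  also have "\<dots> \<le> (\<integral>\<^sup>+x. emeasure (K x) C \<partial>\<nu>)"
    using \<eta>(3) Cs(1) by (intro nn_integral_mono) (simp add: space_nu)
  also have "\<dots> = emeasure \<nu> C" by (rule nu_K[OF Cs(1)])
  finally show ?thesis by (simp add: \<nu>.emeasure_eq_measure)
qed

lemma average_tendsto:
  assumes g: "g \<in> borel_measurable state_space" and bound: "\<And>x. x \<in> E \<Longrightarrow> \<bar>g x\<bar> \<le> c"
  shows "AE \<omega> in M. (\<lambda>n. (\<Sum>i<n. g (Z i \<omega>)) / real n) \<longlonglongrightarrow> (\<integral>x. g x \<partial>\<nu>)"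
proof -
  obtain \<eta> where \<eta>: "sets \<eta> = sets state_space" "emeasure \<eta> (space \<eta>) \<noteq> 0"
    "\<And>x C. x \<in> E \<Longrightarrow> C \<in> sets state_space \<Longrightarrow> emeasure \<eta> C \<le> emeasure (K x) C"
    "\<And>C. C \<in> sets state_space \<Longrightarrow> interior C \<noteq> {} \<Longrightarrow> 0 < emeasure \<eta> C"
    by (rule K_minorization) (rule that; blast)
  show ?thesis
    by (rule doeblin_law_of_large_numbers[where F = past and Z = Z and N = state_space and K = K,
          OF subalgebra_past sets_past_mono Z_past[OF order_refl]
          K_kernel markov_past \<eta>(1,2) _ prob_space_nu sets_nu nu_K g])
      (auto intro: \<eta>(3) bound)
qed

text \<open>Numerator and denominator are both divided by n. A summand of the numerator is known one
  step later and has conditional mean 1_A(Z_i) times \<open>transition_tail\<close>; the denominator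
  averages to \<nu>(A) > 0, so the quotient passes to the limit.\<close>

lemma p_hat_tendsto:
  assumes A: "A \<in> class_C1 E" and B: "B \<in> sets state_space"
  shows "AE \<omega> in M. (\<lambda>n. p_hat Z S n A B s \<omega>)
    \<longlonglongrightarrow> (\<integral>x. indicator A x * transition_tail s B x \<partial>\<nu>) / measure \<nu> A"
proof -
  interpret \<nu>: prob_space \<nu> by (rule prob_space_nu)
  have As: "A \<in> sets state_space" using A by (auto simp: class_C1_def sets_state_space_iff)
  note [measurable] = As B transition_tail_measurable[OF B]
  have [measurable]: "A \<in> sets borel" "B \<in> sets borel" using As B by (auto simp: sets_state_space_iff)
  let ?X = "\<lambda>i \<omega>. indicator {s<..} (S (Suc i) \<omega>) * indicator B (Z (Suc i) \<omega>) :: real"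
  let ?Y = "\<lambda>i \<omega>. indicator A (Z i \<omega>) * ?X i \<omega>"
  let ?g = "\<lambda>x. indicator A x * transition_tail s B x"
  have "AE \<omega> in M. \<forall>i. real_cond_exp M (past i) (?Y i) \<omega> = ?g (Z i \<omega>)"
    unfolding AE_all_countable
  proof
    fix i
    interpret P: finite_measure_subalgebra M "past i" by (rule finite_measure_subalgebra_past)
    have [measurable]: "Z i \<in> past i \<rightarrow>\<^sub>M state_space" by (rule Z_past) simp
    have "AE \<omega> in M. real_cond_exp M (past i) (?Y i) \<omega>
        = indicator A (Z i \<omega>) * real_cond_exp M (past i) (?X i) \<omega>"
      by (intro P.real_cond_exp_mult integrable_const_bound[of _ 1]) (auto split: split_indicator)
    then show "AE \<omega> in M. real_cond_exp M (past i) (?Y i) \<omega> = ?g (Z i \<omega>)"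
      using cond_exp_jump[OF B, of i s] by eventually_elim simp
  qed
  moreover have "AE \<omega> in M. (\<lambda>n. (\<Sum>i<n. ?Y i \<omega> - real_cond_exp M (past i) (?Y i) \<omega>) / real n) \<longlonglongrightarrow> 0"
  proof (rule slln_bounded_martingale_differences[OF subalgebra_past sets_past_mono, where c = 1])
    fix i
    have [measurable]: "Z i \<in> past (Suc i) \<rightarrow>\<^sub>M state_space" "Z (Suc i) \<in> past (Suc i) \<rightarrow>\<^sub>M state_space"
      "S (Suc i) \<in> borel_measurable (past (Suc i))"
      by (auto intro: Z_past S_past)
    show "?Y i \<in> borel_measurable (past (Suc i))" by measurable
  qed (auto split: split_indicator)
  moreover have "AE \<omega> in M. (\<lambda>n. (\<Sum>i<n. ?g (Z i \<omega>)) / real n) \<longlonglongrightarrow> (\<integral>x. ?g x \<partial>\<nu>)"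
    using transition_tail_bounds[OF _ B] by (intro average_tendsto[of _ 1]) (auto split: split_indicator)
  moreover have "AE \<omega> in M. (\<lambda>n. (\<Sum>i<n. indicator A (Z i \<omega>)) / real n) \<longlonglongrightarrow> (\<integral>x. indicator A x \<partial>\<nu>)"
    by (intro average_tendsto[of _ 1]) (auto split: split_indicator)
  ultimately show ?thesis
  proof eventually_elim
    case (elim \<omega>)
    have "(\<lambda>n. (\<Sum>i<n. ?Y i \<omega> - ?g (Z i \<omega>)) / real n + (\<Sum>i<n. ?g (Z i \<omega>)) / real n) \<longlonglongrightarrow> 0 + (\<integral>x. ?g x \<partial>\<nu>)"
      using elim by (intro tendsto_add) auto
    then have num: "(\<lambda>n. (\<Sum>i<n. ?Y i \<omega>) / real n) \<longlonglongrightarrow> (\<integral>x. ?g x \<partial>\<nu>)"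
      by (simp add: sum_subtractf diff_divide_distrib)
    have nuA: "(\<integral>x. indicator A x \<partial>\<nu>) = measure \<nu> A"
      using As sets.sets_into_space[of A \<nu>] by (simp add: sets_nu Int_absorb2)
    have "(\<lambda>n. ((\<Sum>i<n. ?Y i \<omega>) / real n) / ((\<Sum>i<n. indicator A (Z i \<omega>)) / real n))
        \<longlonglongrightarrow> (\<integral>x. ?g x \<partial>\<nu>) / measure \<nu> A"
      using measure_nu_pos[OF A] elim(4) unfolding nuA by (intro tendsto_divide num) auto
    moreover have "\<forall>\<^sub>F n in sequentially. ((\<Sum>i<n. ?Y i \<omega>) / real n) / ((\<Sum>i<n. indicator A (Z i \<omega>)) / real n)
        = p_hat Z S n A B s \<omega>"
      using eventually_gt_at_top[of 0]
      by eventually_elim (simp add: p_hat_def mult_ac)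
    ultimately show ?case by (rule Lim_transform_eventually)
  qed
qed

text \<open>Tonelli's theorem on A x B, after replacing H by \<open>tail_dens\<close>, which is
  legitimate because s lies before the atom of every x in A.\<close>

lemma H_tilde_eq:
  assumes A: "A \<in> class_C1 E" and B: "B \<in> sets state_space"
    and s: "0 \<le> s" "\<And>x. x \<in> A \<Longrightarrow> s < ts x"
  shows "H_tilde E \<Phi> rate q \<mu> \<nu> A B s
    = (\<integral>x. indicator A x * transition_tail s B x \<partial>\<nu>) / measure \<nu> A"
proof -
  interpret \<nu>: prob_space \<nu> by (rule prob_space_nu)
  have As: "A \<in> sets state_space" "A \<subseteq> E" using A by (auto simp: class_C1_def sets_state_space_iff)
  have BE: "B \<subseteq> E" using B by (simp add: sets_state_space_iff)
  note [measurable_cong] = sets_mu sets_nu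
  note [measurable] = As(1) B transition_tail_measurable[OF B] tail_dens_measurable
  have H: "tail_dens s x y = ennreal (H_fun E \<Phi> rate q x y s)" "0 \<le> H_fun E \<Phi> rate q x y s"
    if "x \<in> A" "y \<in> B" for x y
    using that As(2) BE s by (auto intro!: tail_dens_eq_H_fun)
  \<comment> \<open>Joint measurability is known for \<open>tail_dens\<close> and is thereby
    transferred to the integrand of \<open>H_tilde\<close>; on A x B the density is finite, so the
    passage between \<open>ennreal\<close> and \<open>real\<close> is exact.\<close>
  have pt: "indicator (A \<times> B) z *\<^sub>R (case z of (x, y) \<Rightarrow> H_fun E \<Phi> rate q x y s)
      = indicator (A \<times> B) z * enn2real (tail_dens s (fst z) (snd z))"
    and pt': "indicator (A \<times> B) z * tail_dens s (fst z) (snd z)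
      = ennreal (indicator (A \<times> B) z * enn2real (tail_dens s (fst z) (snd z)))" for z
    by (auto simp: H split: split_indicator)
  have "set_lebesgue_integral (\<nu> \<Otimes>\<^sub>M \<mu>) (A \<times> B) (\<lambda>(x, y). H_fun E \<Phi> rate q x y s)
      = (\<integral>z. indicator (A \<times> B) z * enn2real (tail_dens s (fst z) (snd z)) \<partial>(\<nu> \<Otimes>\<^sub>M \<mu>))"
    unfolding set_lebesgue_integral_def pt ..
  also have "\<dots> = enn2real (\<integral>\<^sup>+z. indicator (A \<times> B) z * tail_dens s (fst z) (snd z) \<partial>(\<nu> \<Otimes>\<^sub>M \<mu>))"
    unfolding pt' by (intro integral_eq_nn_integral) auto
  also have "(\<integral>\<^sup>+z. indicator (A \<times> B) z * tail_dens s (fst z) (snd z) \<partial>(\<nu> \<Otimes>\<^sub>M \<mu>))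
      = (\<integral>\<^sup>+x. \<integral>\<^sup>+y. indicator (A \<times> B) (x, y) * tail_dens s x y \<partial>\<mu> \<partial>\<nu>)"
    by (subst mu.nn_integral_fst[symmetric]) auto
  also have "\<dots> = (\<integral>\<^sup>+x. ennreal (indicator A x * transition_tail s B x) \<partial>\<nu>)"
  proof (intro nn_integral_cong)
    fix x assume "x \<in> space \<nu>"
    then have x: "x \<in> E" by (simp add: space_nu)
    have "(\<integral>\<^sup>+y. indicator (A \<times> B) (x, y) * tail_dens s x y \<partial>\<mu>)
        = (\<integral>\<^sup>+y. indicator A x * (tail_dens s x y * indicator B y) \<partial>\<mu>)"
      by (intro nn_integral_cong) (auto split: split_indicator)
    also have "\<dots> = indicator A x * (\<integral>\<^sup>+y\<in>B. tail_dens s x y \<partial>\<mu>)"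
      using tail_dens_measurable2[OF x] by (intro nn_integral_cmult) auto
    also have "\<dots> = ennreal (indicator A x * transition_tail s B x)"
      by (simp add: transition_tail_eq(1)[OF x B] split: split_indicator)
    finally show "(\<integral>\<^sup>+y. indicator (A \<times> B) (x, y) * tail_dens s x y \<partial>\<mu>)
        = ennreal (indicator A x * transition_tail s B x)" .
  qed
  also have "enn2real \<dots> = (\<integral>x. indicator A x * transition_tail s B x \<partial>\<nu>)"
    using transition_tail_bounds[OF _ B]
    by (intro integral_eq_nn_integral[symmetric] AE_I2) (auto simp: space_nu)
  finally show ?thesis by (simp add: H_tilde_def)
qed

text \<open>For every x in A the increments of \<open>transition_tail\<close> in s are bounded by
  those of one continuous function w, and the average over A inherits this bound.\<close>

lemma H_tilde_continuous:
  assumes A: "A \<in> class_C1 E" and B: "B \<in> sets state_space"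
    and t: "\<And>x. x \<in> A \<Longrightarrow> t < ts x"
  shows "continuous_on {0..t} (H_tilde E \<Phi> rate q \<mu> \<nu> A B)"
proof -
  interpret \<nu>: prob_space \<nu> by (rule prob_space_nu)
  have As: "A \<in> sets state_space" "A \<subseteq> E" using A by (auto simp: class_C1_def sets_state_space_iff)
  note [measurable_cong] = sets_nu
  note [measurable] = As(1) transition_tail_measurable[OF B]
  let ?H = "H_tilde E \<Phi> rate q \<mu> \<nu> A B"
  obtain w where w: "\<And>t. continuous_on {0..t} w"
    "\<And>\<xi> s t. \<xi> \<in> E \<Longrightarrow> 0 \<le> s \<Longrightarrow> s \<le> t \<Longrightarrow> G \<xi> s - G \<xi> t \<le> w t - w s"
    using rate_integral_modulus by blast
  have i: "integrable \<nu> (\<lambda>x. indicator A x * transition_tail s B x)" for s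
    using transition_tail_bounds[OF _ B]
    by (intro \<nu>.integrable_const_bound[of _ 1]) (auto simp: space_nu split: split_indicator)
  have diff: "\<bar>?H s - ?H r\<bar> \<le> w r - w s" if sr: "0 \<le> s" "s \<le> r" "r \<le> t" for s r
  proof -
    have ts: "s < ts x" "r < ts x" if "x \<in> A" for x
      using t[OF that] sr by auto
    have "\<bar>(\<integral>x. indicator A x * transition_tail s B x \<partial>\<nu>) - (\<integral>x. indicator A x * transition_tail r B x \<partial>\<nu>)\<bar>
        = \<bar>\<integral>x. indicator A x * transition_tail s B x - indicator A x * transition_tail r B x \<partial>\<nu>\<bar>"
      using i by simp
    also have "\<dots> \<le> (\<integral>x. \<bar>indicator A x * transition_tail s B x - indicator A x * transition_tail r B x\<bar> \<partial>\<nu>)"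
      by (rule integral_abs_bound)
    also have "\<dots> \<le> (\<integral>x. indicator A x * (w r - w s) \<partial>\<nu>)"
    proof (rule integral_mono)
      fix x
      show "\<bar>indicator A x * transition_tail s B x - indicator A x * transition_tail r B x\<bar> \<le> indicator A x * (w r - w s)"
      proof (cases "x \<in> A")
        case True
        then have x: "x \<in> E" using As(2) by auto
        have "\<bar>transition_tail s B x - transition_tail r B x\<bar> \<le> w r - w s"
          using transition_tail_diff[OF x B sr(1,2) ts(2)[OF True]] w(2)[OF x sr(1,2)]
          by (rule order_trans)
        then show ?thesis using True by simp
      qed simp
    qed (use i in \<open>auto intro!: integrable_real_indicator simp: \<nu>.emeasure_eq_measure sets_nu As(1)\<close>)
    also have "\<dots> = (w r - w s) * measure \<nu> A"
      using As(2) by (simp add: space_nu Int_absorb2)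
    finally have "\<bar>(\<integral>x. indicator A x * transition_tail s B x \<partial>\<nu>) - (\<integral>x. indicator A x * transition_tail r B x \<partial>\<nu>)\<bar>
        \<le> (w r - w s) * measure \<nu> A" .
    \<comment> \<open>Integrating the constant bound over A produces the factor \<nu>(A), which the
      normalisation of \<open>H_tilde\<close> cancels.\<close>
    then have "\<bar>(\<integral>x. indicator A x * transition_tail s B x \<partial>\<nu>) - (\<integral>x. indicator A x * transition_tail r B x \<partial>\<nu>)\<bar> / measure \<nu> A
        \<le> w r - w s"
      using measure_nu_pos[OF A] by (simp add: pos_divide_le_eq)
    then show ?thesis
      using measure_nu_pos[OF A] sr ts
      by (simp add: H_tilde_eq[OF A B] diff_divide_distrib[symmetric])
  qed
  show ?thesis
    unfolding continuous_on_iff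
  proof (intro ballI allI impI)
    fix s e :: real assume s: "s \<in> {0..t}" and e: "0 < e"
    then obtain d where d: "0 < d" "\<And>r. r \<in> {0..t} \<Longrightarrow> dist r s < d \<Longrightarrow> dist (w r) (w s) < e"
      using w(1) unfolding continuous_on_iff by metis
    show "\<exists>d>0. \<forall>r\<in>{0..t}. dist r s < d \<longrightarrow> dist (?H r) (?H s) < e"
    proof (intro exI[of _ d] conjI d(1) ballI impI)
      fix r assume r: "r \<in> {0..t}" "dist r s < d"
      show "dist (?H r) (?H s) < e"
        using d(2)[OF r] diff[of s r] diff[of r s] r s unfolding dist_real_def
        by (cases "s \<le> r") auto
    qed
  qed
qed

end

end

theorem proposition2p6:
  fixes E :: "'a::{metric_space, second_countable_topology} set"
    and \<Phi> :: "'a \<Rightarrow> real \<Rightarrow> 'a"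
    and rate :: "'a \<Rightarrow> real"
    and Q :: "'a \<Rightarrow> 'a measure"
    and \<mu> \<nu> :: "'a measure"
    and q :: "'a \<Rightarrow> real \<Rightarrow> 'a \<Rightarrow> real"
    and M :: "'w measure"
    and Z :: "nat \<Rightarrow> 'w \<Rightarrow> 'a"
    and S :: "nat \<Rightarrow> 'w \<Rightarrow> real"
    and A :: "'a set"
    and B :: "nat \<Rightarrow> 'a set"
    and e t :: real
    and p k :: nat
    and x :: 'a
  assumes "regular_pdmp E \<Phi> rate Q \<mu> q"
    and "invariant_prob E \<Phi> rate Q \<nu>"
    and "A \<in> class_C2 E"
    and "0 < e" and "admissible E \<Phi> Q e p B"
    and "1 \<le> k" and "k \<le> p"
    and "0 < t" and "ereal t < hitting_time_set E \<Phi> A"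
    and "x \<in> E"
    and "embedded_chain M E \<Phi> rate Q Z S"
    and "AE \<omega> in M. Z 0 \<omega> = x"
  shows "AE \<omega> in M.
    (\<lambda>n. SUP s\<in>{0..t}. \<bar>p_hat Z S n A (B k) s \<omega> - H_tilde E \<Phi> rate q \<mu> \<nu> A (B k) s\<bar>)
      \<longlonglongrightarrow> 0"
proof -
  interpret regular_chain E \<Phi> rate Q \<mu> q M Z S
    by (intro regular_chain.intro assms)
  have A: "A \<in> class_C1 E" using assms(3) by (simp add: class_C2_def)
  then have AE: "A \<subseteq> E" by (simp add: class_C1_def)
  have "B k \<in> class_C1 E" using assms(5,6,7) by (auto simp: admissible_def)
  then have B: "B k \<in> sets state_space" by (simp add: class_C1_def sets_state_space_iff)
  have tA: "t < ts y" if "y \<in> A" for y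
  proof -
    have "ereal t < hitting_time E \<Phi> y"
      using assms(9) INF_lower[OF that, of "hitting_time E \<Phi>"]
      unfolding hitting_time_set_def by (rule order.strict_trans2)
    then show ?thesis using hitting_time_eq_tstar[of y] that AE by auto
  qed
  \<comment> \<open>Countably many grid points permit all quantifiers inside a single almost sure
    statement. Their unsimplified form matches the grid of the deterministic lemma with a = 0 and b
    = t.\<close>
  have "AE \<omega> in M. \<forall>i N. (\<lambda>n. p_hat Z S n A (B k) (0 + (t - 0) * (real i / real N)) \<omega>)
    \<longlonglongrightarrow> (\<integral>x. indicator A x * transition_tail (0 + (t - 0) * (real i / real N)) (B k) x \<partial>\<nu>) / measure \<nu> A"
    unfolding AE_all_countable using p_hat_tendsto[OF assms(2) A B] by blast
  then show ?thesis
  proof eventually_elim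
    case (elim \<omega>)
    show ?case
    proof (rule SUP_abs_diff_tendsto_0_of_antimono[OF assms(8) p_hat_antimono
          H_tilde_continuous[OF assms(2) A B tA]])
      fix i N :: nat assume iN: "i \<le> N" "0 < N"
      let ?s = "0 + (t - 0) * (real i / real N)"
      \<comment> \<open>The grid stays in [0, t], before every atom over A, so the limit of the
        estimator there is indeed \<open>H_tilde\<close>.\<close>
      have "t * (real i / real N) \<le> t * 1"
        using iN assms(8) by (intro mult_left_mono) auto
      then have "0 \<le> ?s" "?s \<le> t" using assms(8) by auto
      then have "H_tilde E \<Phi> rate q \<mu> \<nu> A (B k) ?s
          = (\<integral>x. indicator A x * transition_tail ?s (B k) x \<partial>\<nu>) / measure \<nu> A"
        using tA by (intro H_tilde_eq[OF assms(2) A B]) force+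
      then show "(\<lambda>n. p_hat Z S n A (B k) ?s \<omega>) \<longlonglongrightarrow> H_tilde E \<Phi> rate q \<mu> \<nu> A (B k) ?s"
        using elim by simp
    qed
  qed
qed

end
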